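(* Let $G$ be a countable infinite discrete group, let $T$ be the nonsingular $(C,F)$-action of $G$ on $(X,\mu)$ associated with admissible $(C,F)$-parameters $\mathcal S$, and let $\Gamma$ be a cofinite subgroup of $G$. Then $T$ has the finite factor $G/\Gamma$ if and only if there are a telescoping $\mathcal T=(C_n,F_{n-1},\kappa_n,\nu_{n-1})_{n=1}^\infty$ of the $(C,F)$-parameters $\mathcal S$ of $T$ and a coset $g\Gamma\in G/\Gamma$ such that $$\sum_{n=1}^\infty\kappa_n\big(\{c\in C_n: c\notin g\Gamma g^{-1}\}\big)<\infty.$$ An explicit formula for the factor mapping is as follows. Identify $X$ with the space of the $(C,F)$-action associated with the telescoping $\mathcal T$ via the canonical isomorphism. Then the factor mapping $X\to G/\Gamma$ is given, for a.e. $x=(f_n,c_{n+1},c_{n+2},\dots)\in F_n\times C_{n+1}\times C_{n+2}\times\cdots$, $n\ge0$, by $$x\mapsto\lim_{m\to\infty}f_nc_{n+1}c_{n+2}\cdots c_m\,g\Gamma\in G/\Gamma .$$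
   Context: Cofinite means of finite index. $G/\Gamma$ is the space of left cosets (with the discrete topology), with $G$ acting by left translations. It is a factor of $T$ if there is a measurable map $\tau:X\to G/\Gamma$ such that for each $g\in G$, $\tau(T_gx)=g\tau(x)$ at $\mu$-a.e. $x\in X$. **$(C,F)$-parameters.** These are sequences $(C_n,F_{n-1},\kappa_n,\nu_{n-1})_{n\ge1}$, where $C_n,F_n$ are finite subsets of $G$, $F_0=\{1_G\}$, $1_G\in F_n\cap C_n$ and $\#C_n>1$ for $n\ge 1$; $F_nC_{n+1}\subset F_{n+1}$ and $F_nc\cap F_nc'=\emptyset$ for distinct $c,c'\in C_{n+1}$, $n\ge0$; $\kappa_n$ is a probability on $C_n$ with full support, with $\prod_{n>0}\max_{c\in C_n}\kappa_n(c)=0$; $\nu_n$ is a finite measure on $F_n$ with full support, $\nu_0(1_G)=1$ and $\nu_{n+1}(fc)=\nu_n(f)\kappa_{n+1}(c)$ for $f\in F_n$, $c\in C_{n+1}$. They are admissible if for all $g\in G$, $n\ge0$: $\lim_{m\to\infty}\nu_m\big((F_nC_{n+1}\cdots C_m)\cap g^{-1}F_m\big)=\nu_n(F_n)$. **$(C,F)$-action.** Let $X_n=F_n\times C_{n+1}\times C_{n+2}\times\cdots$ (product topology), embedded into $X_{n+1}$ by $(f_n,c_{n+1},c_{n+2},\dots)\mapsto(f_nc_{n+1},c_{n+2},\dots)$, and let $X$ be the inductive limit (increasing union) of the $X_n$. For $f\in F_n$ let $[f]_n\subset X_n\subset X$ be the set of points of $X_n$ with first coordinate $f$. $\mu$ is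 the $\sigma$-finite Borel measure on $X$ with $\mu([f]_n)=\nu_n(f)$ for all $f\in F_n$, $n\ge0$. For $g\in G$ let $X^g=\bigcup_{n\ge0}\{(f_n,c_{n+1},\dots)\in X_n: gf_n\in F_n\}$ and $X^G=\bigcap_{g\in G}X^g$. For $x\in X^G$ set $T_gx=(gf_n,c_{n+1},\dots)\in X_n$, where $n$ is such that $x=(f_n,c_{n+1},\dots)\in X_n$ and $gf_n\in F_n$. Admissibility is equivalent to $\mu(X\setminus X^G)=0$, and then $(X,\mu,T)$ is the nonsingular $(C,F)$-action associated with the parameters. **Telescoping.** For integers $0=l_0<l_1<l_2<\cdots$, the corresponding telescoping of $(C_n,F_{n-1},\kappa_n,\nu_{n-1})_{n\ge1}$ is $(\widetilde C_n,\widetilde F_{n-1},\widetilde\kappa_n,\widetilde\nu_{n-1})_{n\ge1}$ with $\widetilde F_n=F_{l_n}$, $\widetilde C_{n+1}=C_{l_n+1}\cdots C_{l_{n+1}}$, $\widetilde\nu_n=\nu_{l_n}$, $\widetilde\kappa_{n+1}=\kappa_{l_n+1}*\cdots*\kappa_{l_{n+1}}$ (convolution on $G$). It is again admissible, and the canonical measure preserving $G$-equivariant isomorphism from $X$ onto the space of its $(C,F)$-action sends $(f_{l_n},c_{l_n+1},c_{l_n+2},\dots)\in X_{l_n}$ to $(f_{l_n},c_{l_n+1}\cdots c_{l_{n+1}},c_{l_{n+1}+1}\cdots c_{l_{n+2}},\dots)$. *)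

theory Defs
  imports "HOL-Probability.Probability" "HOL-Algebra.Left_Coset"
begin

section \<open>Finite products in a group\<close>

definition list_mult :: "('a, 'b) monoid_scheme \<Rightarrow> 'a list \<Rightarrow> 'a" where
  "list_mult G xs = foldr (\<otimes>\<^bsub>G\<^esub>) xs \<one>\<^bsub>G\<^esub>"

definition list_set_mult :: "('a, 'b) monoid_scheme \<Rightarrow> 'a set list \<Rightarrow> 'a set" where
  "list_set_mult G As = foldr (<#>\<^bsub>G\<^esub>) As {\<one>\<^bsub>G\<^esub>}"

definition pmf_conv :: "('a, 'b) monoid_scheme \<Rightarrow> 'a pmf \<Rightarrow> 'a pmf \<Rightarrow> 'a pmf" where
  "pmf_conv G p q = map_pmf (\<lambda>(a, b). a \<otimes>\<^bsub>G\<^esub> b) (pair_pmf p q)"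

definition list_pmf_conv :: "('a, 'b) monoid_scheme \<Rightarrow> 'a pmf list \<Rightarrow> 'a pmf" where
  "list_pmf_conv G ps = foldr (pmf_conv G) ps (return_pmf \<one>\<^bsub>G\<^esub>)"

section \<open>Parameters\<close>

text \<open>
  The sequences \<open>F\<close> and \<open>\<nu>\<close> are indexed from 0, while \<open>C\<close> and \<open>\<kappa>\<close> are indexed from 1; the entries
  of the latter at index 0 are never used. The measure \<open>\<nu>\<^sub>n\<close> is given by its point masses on \<open>F\<^sub>n\<close>.
\<close>

record 'a cf_data =
  cfC :: "nat \<Rightarrow> 'a set"
  cfF :: "nat \<Rightarrow> 'a set"
  cf\<kappa> :: "nat \<Rightarrow> 'a pmf"
  cf\<nu> :: "nat \<Rightarrow> 'a \<Rightarrow> real"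

definition cf_parameters :: "('a, 'b) monoid_scheme \<Rightarrow> 'a cf_data \<Rightarrow> bool" where
  "cf_parameters G S \<longleftrightarrow>
     cfF S 0 = {\<one>\<^bsub>G\<^esub>} \<and>
     (\<forall>n. finite (cfF S n) \<and> cfF S n \<subseteq> carrier G) \<and>
     (\<forall>n\<ge>1. finite (cfC S n) \<and> cfC S n \<subseteq> carrier G) \<and>
     (\<forall>n\<ge>1. \<one>\<^bsub>G\<^esub> \<in> cfF S n \<inter> cfC S n \<and> card (cfC S n) > 1) \<and>
     (\<forall>n. cfF S n <#>\<^bsub>G\<^esub> cfC S (Suc n) \<subseteq> cfF S (Suc n)) \<and>
     (\<forall>n. \<forall>c\<in>cfC S (Suc n). \<forall>c'\<in>cfC S (Suc n). c \<noteq> c' \<longrightarrow>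
        (cfF S n #>\<^bsub>G\<^esub> c) \<inter> (cfF S n #>\<^bsub>G\<^esub> c') = {}) \<and>
     (\<forall>n\<ge>1. set_pmf (cf\<kappa> S n) = cfC S n) \<and>
     (\<lambda>N. \<Prod>n=1..N. Max (pmf (cf\<kappa> S n) ` cfC S n)) \<longlonglongrightarrow> 0 \<and>
     (\<forall>n. \<forall>f\<in>cfF S n. cf\<nu> S n f > 0) \<and>
     cf\<nu> S 0 \<one>\<^bsub>G\<^esub> = 1 \<and>
     (\<forall>n. \<forall>f\<in>cfF S n. \<forall>c\<in>cfC S (Suc n).
        cf\<nu> S (Suc n) (f \<otimes>\<^bsub>G\<^esub> c) = cf\<nu> S n f * pmf (cf\<kappa> S (Suc n)) c)"

definition cf_admissible :: "('a, 'b) monoid_scheme \<Rightarrow> 'a cf_data \<Rightarrow> bool" where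
  "cf_admissible G S \<longleftrightarrow>
     (\<forall>g\<in>carrier G. \<forall>n.
        (\<lambda>m. \<Sum>f \<in> (cfF S n <#>\<^bsub>G\<^esub> list_set_mult G (map (cfC S) [Suc n..<Suc m])) \<inter>
                   (inv\<^bsub>G\<^esub> g <#\<^bsub>G\<^esub> cfF S m). cf\<nu> S m f)
        \<longlonglongrightarrow> (\<Sum>f\<in>cfF S n. cf\<nu> S n f))"

section \<open>The space\<close>

text \<open>
  A point \<open>(f\<^sub>n, c\<^sub>n\<^sub>+\<^sub>1, c\<^sub>n\<^sub>+\<^sub>2, \<dots>)\<close> of \<open>X\<^sub>n\<close> is the sequence \<open>s\<close> with \<open>s 0 = f\<^sub>n\<close> and
  \<open>s i = c\<^sub>n\<^sub>+\<^sub>i\<close> for \<open>i > 0\<close>.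
\<close>

definition cf_level_top :: "'a cf_data \<Rightarrow> nat \<Rightarrow> (nat \<Rightarrow> 'a) topology" where
  "cf_level_top S n =
     product_topology (\<lambda>i. discrete_topology (if i = 0 then cfF S n else cfC S (n + i))) UNIV"

definition cf_level :: "'a cf_data \<Rightarrow> nat \<Rightarrow> (nat \<Rightarrow> 'a) set" where
  "cf_level S n = topspace (cf_level_top S n)"

lemma mem_cf_level:
  "s \<in> cf_level S n \<longleftrightarrow> s 0 \<in> cfF S n \<and> (\<forall>i>0. s i \<in> cfC S (n + i))"
  by (auto simp: cf_level_def cf_level_top_def PiE_def Pi_def)

definition cf_embed :: "('a, 'b) monoid_scheme \<Rightarrow> (nat \<Rightarrow> 'a) \<Rightarrow> (nat \<Rightarrow> 'a)" where
  "cf_embed G s = (\<lambda>i. if i = 0 then s 0 \<otimes>\<^bsub>G\<^esub> s 1 else s (Suc i))"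

text \<open>
  The inductive limit is the quotient of the disjoint union of the \<open>X\<^sub>n\<close> which identifies two
  points when they agree at some common later level.
\<close>

definition cf_rel ::
  "('a, 'b) monoid_scheme \<Rightarrow> 'a cf_data \<Rightarrow> ((nat \<times> (nat \<Rightarrow> 'a)) \<times> (nat \<times> (nat \<Rightarrow> 'a))) set" where
  "cf_rel G S = {((n, s), (m, t)). s \<in> cf_level S n \<and> t \<in> cf_level S m \<and>
     (\<exists>k. n \<le> k \<and> m \<le> k \<and> (cf_embed G ^^ (k - n)) s = (cf_embed G ^^ (k - m)) t)}"

definition cf_space :: "('a, 'b) monoid_scheme \<Rightarrow> 'a cf_data \<Rightarrow> (nat \<times> (nat \<Rightarrow> 'a)) set set" where
  "cf_space G S = (SIGMA n:UNIV. cf_level S n) // cf_rel G S"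

definition cf_point ::
  "('a, 'b) monoid_scheme \<Rightarrow> 'a cf_data \<Rightarrow> nat \<Rightarrow> (nat \<Rightarrow> 'a) \<Rightarrow> (nat \<times> (nat \<Rightarrow> 'a)) set" where
  "cf_point G S n s = cf_rel G S `` {(n, s)}"

lemma equiv_cf_rel: "equiv (SIGMA n:UNIV. cf_level S n) (cf_rel G S)"
proof (rule equivI)
  show "cf_rel G S \<subseteq> (SIGMA n:UNIV. cf_level S n) \<times> (SIGMA n:UNIV. cf_level S n)"
    by (auto simp: cf_rel_def)
  show "refl_on (SIGMA n:UNIV. cf_level S n) (cf_rel G S)"
    by (auto simp: refl_on_def cf_rel_def)
  show "sym (cf_rel G S)"
    by (auto simp: sym_def cf_rel_def)
  have up: "(cf_embed G ^^ (k' - n)) s = (cf_embed G ^^ (k' - m)) t"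
    if "(cf_embed G ^^ (k - n)) s = (cf_embed G ^^ (k - m)) t" "n \<le> k" "m \<le> k" "k \<le> k'"
    for n m k k' s t
  proof -
    have "k' - n = (k' - k) + (k - n)" "k' - m = (k' - k) + (k - m)"
      using that by auto
    then show ?thesis
      using that(1) by (simp only: funpow_add o_apply)
  qed
  show "trans (cf_rel G S)"
  proof (rule transI)
    fix p q r
    assume pq: "(p, q) \<in> cf_rel G S" and qr: "(q, r) \<in> cf_rel G S"
    obtain n s m t i u where eqs: "p = (n, s)" "q = (m, t)" "r = (i, u)"
      by (metis surj_pair)
    from pq obtain k where k: "n \<le> k" "m \<le> k"
      "(cf_embed G ^^ (k - n)) s = (cf_embed G ^^ (k - m)) t"
      by (auto simp: cf_rel_def eqs)
    from qr obtain k' where k': "m \<le> k'" "i \<le> k'"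
      "(cf_embed G ^^ (k' - m)) t = (cf_embed G ^^ (k' - i)) u"
      by (auto simp: cf_rel_def eqs)
    have "(cf_embed G ^^ (max k k' - n)) s = (cf_embed G ^^ (max k k' - i)) u"
      using up[OF k(3,1,2), of "max k k'"] up[OF k'(3,1,2), of "max k k'"] by simp
    then show "(p, r) \<in> cf_rel G S"
      using pq qr k k' by (auto simp: cf_rel_def eqs intro!: exI[of _ "max k k'"])
  qed
qed

text \<open>The inductive limit topology, and the measure \<open>\<mu>\<close> on its Borel sets.\<close>

definition cf_top ::
  "('a, 'b) monoid_scheme \<Rightarrow> 'a cf_data \<Rightarrow> (nat \<times> (nat \<Rightarrow> 'a)) set topology" where
  "cf_top G S = topology (\<lambda>U. U \<subseteq> cf_space G S \<and>
     (\<forall>n. openin (cf_level_top S n) {s \<in> cf_level S n. cf_point G S n s \<in> U}))"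

lemma openin_cf_top:
  "openin (cf_top G S) U \<longleftrightarrow> U \<subseteq> cf_space G S \<and>
     (\<forall>n. openin (cf_level_top S n) {s \<in> cf_level S n. cf_point G S n s \<in> U})"
proof -
  have "istopology (\<lambda>U. U \<subseteq> cf_space G S \<and>
     (\<forall>n. openin (cf_level_top S n) {s \<in> cf_level S n. cf_point G S n s \<in> U}))"
    unfolding istopology_def
  proof (intro conjI allI impI)
    fix U V n
    assume U: "U \<subseteq> cf_space G S \<and>
        (\<forall>n. openin (cf_level_top S n) {s \<in> cf_level S n. cf_point G S n s \<in> U})"
      and V: "V \<subseteq> cf_space G S \<and>
        (\<forall>n. openin (cf_level_top S n) {s \<in> cf_level S n. cf_point G S n s \<in> V})"
    then show "U \<inter> V \<subseteq> cf_space G S" by blast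
    have "{s \<in> cf_level S n. cf_point G S n s \<in> U \<inter> V} =
        {s \<in> cf_level S n. cf_point G S n s \<in> U} \<inter> {s \<in> cf_level S n. cf_point G S n s \<in> V}"
      by blast
    then show "openin (cf_level_top S n) {s \<in> cf_level S n. cf_point G S n s \<in> U \<inter> V}"
      using U V by (simp add: openin_Int)
  next
    fix \<U> n
    assume *: "\<forall>U\<in>\<U>. U \<subseteq> cf_space G S \<and>
        (\<forall>n. openin (cf_level_top S n) {s \<in> cf_level S n. cf_point G S n s \<in> U})"
    then show "\<Union>\<U> \<subseteq> cf_space G S" by blast
    have "{s \<in> cf_level S n. cf_point G S n s \<in> \<Union>\<U>} =
        (\<Union>U\<in>\<U>. {s \<in> cf_level S n. cf_point G S n s \<in> U})"
      by blast
    then show "openin (cf_level_top S n) {s \<in> cf_level S n. cf_point G S n s \<in> \<Union>\<U>}"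
      using * by auto
  qed
  then show ?thesis
    unfolding cf_top_def by (subst topology_inverse') simp_all
qed

definition cf_cylinder ::
  "('a, 'b) monoid_scheme \<Rightarrow> 'a cf_data \<Rightarrow> nat \<Rightarrow> 'a \<Rightarrow> (nat \<times> (nat \<Rightarrow> 'a)) set set" where
  "cf_cylinder G S n f = cf_point G S n ` {s \<in> cf_level S n. s 0 = f}"

definition cf_measure ::
  "('a, 'b) monoid_scheme \<Rightarrow> 'a cf_data \<Rightarrow> (nat \<times> (nat \<Rightarrow> 'a)) set measure \<Rightarrow> bool" where
  "cf_measure G S \<mu> \<longleftrightarrow>
     space \<mu> = cf_space G S \<and>
     sets \<mu> = sigma_sets (cf_space G S) {U. openin (cf_top G S) U} \<and>
     sigma_finite_measure \<mu> \<and>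
     (\<forall>n. \<forall>f\<in>cfF S n. emeasure \<mu> (cf_cylinder G S n f) = ennreal (cf\<nu> S n f))"

section \<open>The action and its finite factors\<close>

definition cf_dom ::
  "('a, 'b) monoid_scheme \<Rightarrow> 'a cf_data \<Rightarrow> 'a \<Rightarrow> (nat \<times> (nat \<Rightarrow> 'a)) set set" where
  "cf_dom G S g = (\<Union>n. cf_point G S n ` {s \<in> cf_level S n. g \<otimes>\<^bsub>G\<^esub> s 0 \<in> cfF S n})"

definition cf_total_dom ::
  "('a, 'b) monoid_scheme \<Rightarrow> 'a cf_data \<Rightarrow> (nat \<times> (nat \<Rightarrow> 'a)) set set" where
  "cf_total_dom G S = (\<Inter>g\<in>carrier G. cf_dom G S g)"

text \<open>
  On \<open>X\<^sup>G\<close> the value \<open>T\<^sub>g x\<close> does not depend on the level chosen to represent \<open>x\<close>. For admissible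
  parameters the complement of \<open>X\<^sup>G\<close> is \<open>\<mu>\<close>-null; there \<open>T\<^sub>g\<close> is set to be the identity.
\<close>

definition cf_act ::
  "('a, 'b) monoid_scheme \<Rightarrow> 'a cf_data \<Rightarrow> 'a \<Rightarrow>
    (nat \<times> (nat \<Rightarrow> 'a)) set \<Rightarrow> (nat \<times> (nat \<Rightarrow> 'a)) set" where
  "cf_act G S g x = (if x \<in> cf_total_dom G S then
     (THE y. \<exists>n. \<exists>s\<in>cf_level S n. x = cf_point G S n s \<and>
        g \<otimes>\<^bsub>G\<^esub> s 0 \<in> cfF S n \<and> y = cf_point G S n (s(0 := g \<otimes>\<^bsub>G\<^esub> s 0)))
     else x)"

definition cf_factor_map ::
  "('a, 'b) monoid_scheme \<Rightarrow> 'a cf_data \<Rightarrow> (nat \<times> (nat \<Rightarrow> 'a)) set measure \<Rightarrow> 'a set \<Rightarrow>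
    ((nat \<times> (nat \<Rightarrow> 'a)) set \<Rightarrow> 'a set) \<Rightarrow> bool" where
  "cf_factor_map G S \<mu> \<Gamma> \<tau> \<longleftrightarrow>
     \<tau> \<in> measurable \<mu> (count_space (lcosets\<^bsub>G\<^esub> \<Gamma>)) \<and>
     (\<forall>g\<in>carrier G. AE x in \<mu>. \<tau> (cf_act G S g x) = g <#\<^bsub>G\<^esub> \<tau> x)"

definition cf_has_factor ::
  "('a, 'b) monoid_scheme \<Rightarrow> 'a cf_data \<Rightarrow> (nat \<times> (nat \<Rightarrow> 'a)) set measure \<Rightarrow> 'a set \<Rightarrow> bool" where
  "cf_has_factor G S \<mu> \<Gamma> \<longleftrightarrow> (\<exists>\<tau>. cf_factor_map G S \<mu> \<Gamma> \<tau>)"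

section \<open>Telescoping\<close>

definition telescoping_seq :: "(nat \<Rightarrow> nat) \<Rightarrow> bool" where
  "telescoping_seq l \<longleftrightarrow> l 0 = 0 \<and> strict_mono l"

definition cf_telescope ::
  "('a, 'b) monoid_scheme \<Rightarrow> 'a cf_data \<Rightarrow> (nat \<Rightarrow> nat) \<Rightarrow> 'a cf_data" where
  "cf_telescope G S l =
     \<lparr>cfC = (\<lambda>n. list_set_mult G (map (cfC S) [Suc (l (n - 1))..<Suc (l n)])),
      cfF = (\<lambda>n. cfF S (l n)),
      cf\<kappa> = (\<lambda>n. list_pmf_conv G (map (cf\<kappa> S) [Suc (l (n - 1))..<Suc (l n)])),
      cf\<nu> = (\<lambda>n. cf\<nu> S (l n))\<rparr>"

text \<open>
  For \<open>s = (f, c\<^bsub>l n + 1\<^esub>, c\<^bsub>l n + 2\<^esub>, \<dots>)\<close> in \<open>X\<^bsub>l n\<^esub>\<close>, the entry \<open>c\<^sub>j\<close> is \<open>s (j - l n)\<close>; so entry \<open>i > 0\<close>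
  below is the product of the \<open>c\<^sub>j\<close> with \<open>l (n + i - 1) < j \<le> l (n + i)\<close>.
\<close>

definition cf_block ::
  "('a, 'b) monoid_scheme \<Rightarrow> (nat \<Rightarrow> nat) \<Rightarrow> nat \<Rightarrow> (nat \<Rightarrow> 'a) \<Rightarrow> (nat \<Rightarrow> 'a)" where
  "cf_block G l n s = (\<lambda>i. if i = 0 then s 0 else
     list_mult G (map (\<lambda>j. s (j - l n)) [Suc (l (n + i - 1))..<Suc (l (n + i))]))"

text \<open>The canonical isomorphism onto the space of the telescoped parameters.\<close>

definition cf_telescope_iso ::
  "('a, 'b) monoid_scheme \<Rightarrow> 'a cf_data \<Rightarrow> (nat \<Rightarrow> nat) \<Rightarrow>
    (nat \<times> (nat \<Rightarrow> 'a)) set \<Rightarrow> (nat \<times> (nat \<Rightarrow> 'a)) set" where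
  "cf_telescope_iso G S l x = (THE y. \<exists>n. \<exists>s\<in>cf_level S (l n). x = cf_point G S (l n) s \<and>
     y = cf_point G (cf_telescope G S l) n (cf_block G l n s))"

definition cf_coset_summable ::
  "('a, 'b) monoid_scheme \<Rightarrow> 'a cf_data \<Rightarrow> 'a set \<Rightarrow> 'a \<Rightarrow> bool" where
  "cf_coset_summable G S \<Gamma> g \<longleftrightarrow>
     summable (\<lambda>n. measure_pmf.prob (cf\<kappa> S (Suc n))
       {c \<in> cfC S (Suc n). c \<notin> (g <#\<^bsub>G\<^esub> \<Gamma>) #>\<^bsub>G\<^esub> (inv\<^bsub>G\<^esub> g)})"

text \<open>
  Almost every \<open>x\<close>, written as \<open>(f\<^sub>n, c\<^sub>n\<^sub>+\<^sub>1, \<dots>)\<close> in the telescoped space at any level \<open>n\<close>, satisfies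
  \<open>f\<^sub>n c\<^sub>n\<^sub>+\<^sub>1 \<cdots> c\<^sub>n\<^sub>+\<^sub>k g \<Gamma> \<longlonglongrightarrow> \<tau> x\<close> as \<open>k\<close> tends to infinity, in the discrete space \<open>G/\<Gamma>\<close>.
\<close>

definition cf_factor_formula ::
  "('a, 'b) monoid_scheme \<Rightarrow> 'a cf_data \<Rightarrow> (nat \<times> (nat \<Rightarrow> 'a)) set measure \<Rightarrow> 'a set \<Rightarrow>
    (nat \<Rightarrow> nat) \<Rightarrow> 'a \<Rightarrow> ((nat \<times> (nat \<Rightarrow> 'a)) set \<Rightarrow> 'a set) \<Rightarrow> bool" where
  "cf_factor_formula G S \<mu> \<Gamma> l g \<tau> \<longleftrightarrow>
     (AE x in \<mu>. \<forall>n. \<forall>s\<in>cf_level (cf_telescope G S l) n.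
        cf_telescope_iso G S l x = cf_point G (cf_telescope G S l) n s \<longrightarrow>
        limitin (discrete_topology (lcosets\<^bsub>G\<^esub> \<Gamma>))
          (\<lambda>k. (list_mult G (map s [0..<Suc k]) \<otimes>\<^bsub>G\<^esub> g) <#\<^bsub>G\<^esub> \<Gamma>) (\<tau> x) sequentially)"

end

theory Submission
  imports Defs
begin

text \<open>
  Put \<open>\<pi>\<^sub>m(q) = \<mu>([1]\<^sub>m \<inter> {\<tau> = q}) / \<nu>\<^sub>m(1)\<close> for a factor map \<open>\<tau>\<close>. Since \<open>T\<^sub>f\<close> maps \<open>[1]\<^sub>m\<close> onto \<open>[f]\<^sub>m\<close>
  and multiplies the measure by a constant, the conditional distribution of \<open>\<tau>\<close> on \<open>[f]\<^sub>m\<close> is \<open>f \<pi>\<^sub>m\<close>, so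
  \<open>\<pi>\<^sub>m\<close> is the \<open>\<kappa>\<^bsub>m+1\<^esub> * \<dots> * \<kappa>\<^sub>n\<close>-average of the translates \<open>c \<pi>\<^sub>n\<close>. Hence \<open>max \<pi>\<^sub>m\<close> increases with \<open>m\<close>, and
  its limit is 1 because the level sets of \<open>\<tau>\<close> are approximated by unions of cylinders. As \<open>G/\<Gamma>\<close> is
  finite, there are one coset \<open>q = g\<Gamma>\<close> and levels \<open>l n\<close> with \<open>\<pi>\<^bsub>l n\<^esub>(q) \<ge> 1 - 2\<^bsup>-n\<^esup>\<close>. Comparing two consecutive
  levels shows that the telescoped \<open>\<kappa>\<close> moves \<open>q\<close> with summable probability, and Borel--Cantelli gives
  \<open>\<tau> = f c\<^bsub>n+1\<^esub> \<cdots> c\<^sub>m q\<close> eventually along these levels. Conversely, under the summability condition almost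
  every sequence of these cosets is eventually constant by Borel--Cantelli, and its limit is
  equivariant.
\<close>

section \<open>Products in groups\<close>

lemma list_mult_simps [simp]:
  "list_mult G [] = \<one>\<^bsub>G\<^esub>"
  "list_mult G (x # xs) = x \<otimes>\<^bsub>G\<^esub> list_mult G xs"
  by (simp_all add: list_mult_def)

lemma (in monoid) list_mult_closed: "set xs \<subseteq> carrier G \<Longrightarrow> list_mult G xs \<in> carrier G"
  by (induction xs) auto

lemma (in monoid) list_mult_append:
  "set xs \<subseteq> carrier G \<Longrightarrow> set ys \<subseteq> carrier G \<Longrightarrow>
     list_mult G (xs @ ys) = list_mult G xs \<otimes> list_mult G ys"
  by (induction xs) (auto simp: list_mult_closed m_assoc)

lemma list_set_mult_simps [simp]:
  "list_set_mult G [] = {\<one>\<^bsub>G\<^esub>}"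
  "list_set_mult G (A # As) = A <#>\<^bsub>G\<^esub> list_set_mult G As"
  by (simp_all add: list_set_mult_def)

lemma list_mult_in_list_set_mult:
  "list_all2 (\<in>) xs As \<Longrightarrow> list_mult G xs \<in> list_set_mult G As"
  by (induction xs As rule: list_all2_induct) (auto simp: set_mult_def)

lemma list_pmf_conv_simps [simp]:
  "list_pmf_conv G [] = return_pmf \<one>\<^bsub>G\<^esub>"
  "list_pmf_conv G (p # ps) = pmf_conv G p (list_pmf_conv G ps)"
  by (simp_all add: list_pmf_conv_def)

lemma set_pmf_conv: "set_pmf (pmf_conv G p q) = set_pmf p <#>\<^bsub>G\<^esub> set_pmf q"
  by (auto simp: pmf_conv_def set_mult_def)

lemma pmf_conv_inj:
  assumes "inj_on (\<lambda>(a, b). a \<otimes>\<^bsub>G\<^esub> b) (set_pmf p \<times> set_pmf q)" "a \<in> set_pmf p" "b \<in> set_pmf q"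
  shows "pmf (pmf_conv G p q) (a \<otimes>\<^bsub>G\<^esub> b) = pmf p a * pmf q b"
proof -
  have "pmf (pmf_conv G p q) ((\<lambda>(a, b). a \<otimes>\<^bsub>G\<^esub> b) (a, b)) = pmf (pair_pmf p q) (a, b)"
    unfolding pmf_conv_def using assms by (intro pmf_map_inj) auto
  then show ?thesis by (simp add: pmf_pair)
qed

text \<open>The stabilizer of the coset \<open>g <# H\<close> under left translation is the
  conjugate of \<open>H\<close> by \<open>g\<close>. This turns the set in
  \<open>cf_coset_summable\<close> into the set of those \<open>c\<close> that move the
  coset.\<close>

lemma (in group) l_coset_eq_iff_conj:
  assumes "subgroup H G" "g \<in> carrier G" "c \<in> carrier G"
  shows "c \<otimes> g <# H = g <# H \<longleftrightarrow> c \<in> (g <# H) #> inv g"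
proof -
  interpret subgroup H G by fact
  have "c \<in> (g <# H) #> inv g \<longleftrightarrow> c \<otimes> g \<in> g <# H"
  proof
    assume "c \<in> (g <# H) #> inv g"
    then obtain h where "h \<in> H" "c = g \<otimes> h \<otimes> inv g"
      by (auto simp: r_coset_def l_coset_def)
    then show "c \<otimes> g \<in> g <# H"
      using assms by (auto simp: l_coset_def m_assoc)
  next
    assume "c \<otimes> g \<in> g <# H"
    then have "c \<otimes> g \<otimes> inv g \<in> (g <# H) #> inv g"
      by (auto simp: r_coset_def)
    then show "c \<in> (g <# H) #> inv g"
      using assms by (simp add: m_assoc)
  qed
  also have "\<dots> \<longleftrightarrow> c \<otimes> g <# H = g <# H"
    using assms l_repr_independence[of "c \<otimes> g" g H] lcos_self[of "c \<otimes> g" H] by auto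
  finally show ?thesis by simp
qed

section \<open>Cylinders\<close>

locale cf_system = group G for G (structure) +
  fixes S :: "'a cf_data"
  assumes params: "cf_parameters G S"
begin

abbreviation "C \<equiv> cfC S"
abbreviation "F \<equiv> cfF S"
abbreviation "\<nu> \<equiv> cf\<nu> S"
abbreviation "L \<equiv> cf_level S"
abbreviation "emb \<equiv> cf_embed G"
abbreviation "pt \<equiv> cf_point G S"
abbreviation "cyl \<equiv> cf_cylinder G S"
abbreviation "X \<equiv> cf_space G S"

text \<open>The words leading from level \<open>m\<close> to level \<open>n\<close>: the product of
  \<open>C (Suc m)\<close> up to \<open>C n\<close>. \<open>KK m n\<close> below is their
  distribution. A telescoping along \<open>l\<close> has \<open>CC (l n) (l (Suc n))\<close> and
  \<open>KK (l n) (l (Suc n))\<close> as its entries of index \<open>Suc n\<close>.\<close>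

definition CC :: "nat \<Rightarrow> nat \<Rightarrow> 'a set" where
  "CC m n = list_set_mult G (map C [Suc m..<Suc n])"

definition KK :: "nat \<Rightarrow> nat \<Rightarrow> 'a pmf" where
  "KK m n = list_pmf_conv G (map (cf\<kappa> S) [Suc m..<Suc n])"

lemma finite_F [simp]: "finite (F n)"
  using params by (simp add: cf_parameters_def)

lemma F_carrier: "f \<in> F n \<Longrightarrow> f \<in> carrier G"
  using params by (auto simp: cf_parameters_def)

lemma C_carrier: "c \<in> C (Suc n) \<Longrightarrow> c \<in> carrier G"
  using params by (auto simp: cf_parameters_def)

lemma finite_C: "finite (C (Suc n))"
  using params by (auto simp: cf_parameters_def)

lemma one_F [simp]: "\<one> \<in> F n"
  using params by (cases n) (auto simp: cf_parameters_def)

lemma F_mult_C: "f \<in> F n \<Longrightarrow> c \<in> C (Suc n) \<Longrightarrow> f \<otimes> c \<in> F (Suc n)"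
proof -
  assume "f \<in> F n" "c \<in> C (Suc n)"
  then have "f \<otimes> c \<in> F n <#> C (Suc n)" by (auto simp: set_mult_def)
  also have "\<dots> \<subseteq> F (Suc n)" using params by (simp add: cf_parameters_def)
  finally show ?thesis .
qed

lemma F_mult_C_inj:
  assumes "f \<in> F n" "c \<in> C (Suc n)" "f' \<in> F n" "c' \<in> C (Suc n)" "f \<otimes> c = f' \<otimes> c'"
  shows "f = f' \<and> c = c'"
proof -
  have "c = c'"
  proof (rule ccontr)
    assume "c \<noteq> c'"
    then have "(F n #> c) \<inter> (F n #> c') = {}"
      using params assms(2,4) by (simp add: cf_parameters_def)
    moreover have "f \<otimes> c \<in> F n #> c" "f' \<otimes> c' \<in> F n #> c'"
      using assms(1-4) by (auto simp: r_coset_def)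
    ultimately show False using assms(5) by auto
  qed
  then show ?thesis
    using assms F_carrier C_carrier by (metis right_cancel)
qed

lemma set_pmf_\<kappa>: "set_pmf (cf\<kappa> S (Suc n)) = C (Suc n)"
  using params by (simp add: cf_parameters_def)

lemma \<nu>_pos: "f \<in> F n \<Longrightarrow> \<nu> n f > 0"
  using params by (simp add: cf_parameters_def)

lemma \<nu>_0: "\<nu> 0 \<one> = 1"
  using params by (simp add: cf_parameters_def)

lemma \<nu>_mult: "f \<in> F n \<Longrightarrow> c \<in> C (Suc n) \<Longrightarrow> \<nu> (Suc n) (f \<otimes> c) = \<nu> n f * pmf (cf\<kappa> S (Suc n)) c"
  using params by (simp add: cf_parameters_def)

section \<open>Words between two levels: unique factorization and masses\<close>

lemma CC_refl [simp]: "CC n n = {\<one>}"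
  by (simp add: CC_def)

lemma CC_Suc: "m < n \<Longrightarrow> CC m n = C (Suc m) <#> CC (Suc m) n"
  by (simp add: CC_def upt_conv_Cons del: upt_Suc)

lemma KK_refl [simp]: "KK n n = return_pmf \<one>"
  by (simp add: KK_def)

lemma KK_Suc: "m < n \<Longrightarrow> KK m n = pmf_conv G (cf\<kappa> S (Suc m)) (KK (Suc m) n)"
  by (simp add: KK_def upt_conv_Cons del: upt_Suc)

lemma set_pmf_KK: "m \<le> n \<Longrightarrow> set_pmf (KK m n) = CC m n"
  by (induction rule: inc_induct) (simp_all add: KK_Suc CC_Suc set_pmf_conv set_pmf_\<kappa>)

lemma finite_CC: "m \<le> n \<Longrightarrow> finite (CC m n)"
  by (induction rule: inc_induct) (auto simp: CC_Suc finite_C set_mult_def)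

lemma CC_carrier: "m \<le> n \<Longrightarrow> CC m n \<subseteq> carrier G"
  by (induction rule: inc_induct) (auto simp: CC_Suc set_mult_def C_carrier subset_iff)

lemma F_mult_CC: "m \<le> n \<Longrightarrow> f \<in> F m \<Longrightarrow> c \<in> CC m n \<Longrightarrow> f \<otimes> c \<in> F n"
proof (induction arbitrary: f c rule: inc_induct)
  case base
  then show ?case using F_carrier by auto
next
  case (step m)
  then obtain a b where ab: "c = a \<otimes> b" "a \<in> C (Suc m)" "b \<in> CC (Suc m) n"
    by (auto simp: CC_Suc set_mult_def)
  then have "f \<otimes> a \<otimes> b \<in> F n"
    using step by (auto intro: F_mult_C)
  then show ?case
    using ab step CC_carrier[of "Suc m" n] F_carrier C_carrier by (simp add: m_assoc subset_iff)
qed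

lemma C_sub_F: "C (Suc m) \<subseteq> F (Suc m)"
  using F_mult_C[OF one_F] C_carrier by auto

text \<open>Peel off the first letter of the word: it is absorbed into \<open>F (Suc m)\<close>,
  where the induction hypothesis separates it from the remaining word, and the one-step disjointness
  of the translates of \<open>F m\<close> then separates \<open>f\<close> from the letter.\<close>

lemma F_mult_CC_inj:
  "m \<le> n \<Longrightarrow> inj_on (\<lambda>(f, c). f \<otimes> c) (F m \<times> CC m n)"
proof (induction rule: inc_induct)
  case base
  then show ?case using F_carrier by (auto simp: inj_on_def)
next
  case (step m)
  have car: "CC (Suc m) n \<subseteq> carrier G" using step CC_carrier by simp
  show ?case
  proof (rule inj_onI, clarify)
    fix f c f' c'
    assume *: "f \<in> F m" "c \<in> CC m n" "f' \<in> F m" "c' \<in> CC m n" "f \<otimes> c = f' \<otimes> c'"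
    obtain a b where ab: "c = a \<otimes> b" "a \<in> C (Suc m)" "b \<in> CC (Suc m) n"
      using * step by (auto simp: CC_Suc set_mult_def)
    obtain a' b' where ab': "c' = a' \<otimes> b'" "a' \<in> C (Suc m)" "b' \<in> CC (Suc m) n"
      using * step by (auto simp: CC_Suc set_mult_def)
    have "f \<otimes> a \<otimes> b = f' \<otimes> a' \<otimes> b'"
      using * ab ab' car F_carrier C_carrier by (simp add: m_assoc subset_iff)
    then have "f \<otimes> a = f' \<otimes> a' \<and> b = b'"
      using inj_onD[OF step.IH, of "(f \<otimes> a, b)" "(f' \<otimes> a', b')"] * ab ab' F_mult_C by simp
    then show "f = f' \<and> c = c'"
      using F_mult_C_inj[of f m a f' a'] * ab ab' by simp
  qed
qed

text \<open>Given the cylinder of \<open>f\<close> at level \<open>m\<close>, the word read up to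
  level \<open>n\<close> has distribution \<open>KK m n\<close>, whatever \<open>f\<close> is. This
  independence of \<open>f\<close> is what makes the action scale cylinders by constants.\<close>

lemma \<nu>_mult_CC:
  "m \<le> n \<Longrightarrow> f \<in> F m \<Longrightarrow> c \<in> CC m n \<Longrightarrow> \<nu> n (f \<otimes> c) = \<nu> m f * pmf (KK m n) c"
proof (induction arbitrary: f c rule: inc_induct)
  case base
  then show ?case using F_carrier by simp
next
  case (step m)
  have car: "CC (Suc m) n \<subseteq> carrier G" using step CC_carrier by simp
  obtain a b where ab: "c = a \<otimes> b" "a \<in> C (Suc m)" "b \<in> CC (Suc m) n"
    using step by (auto simp: CC_Suc set_mult_def)
  \<comment> \<open>As \<open>F m\<close> contains the identity, \<open>C (Suc m)\<close> lies in
    \<open>F (Suc m)\<close>, so unique factorization applies to letter times word; hence no masses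
    merge in the convolution.\<close>
  have "inj_on (\<lambda>(a, b). a \<otimes> b) (C (Suc m) \<times> CC (Suc m) n)"
    using F_mult_CC_inj[of "Suc m" n] C_sub_F[of m] step by (auto intro: inj_on_subset)
  then have "pmf (KK m n) c = pmf (cf\<kappa> S (Suc m)) a * pmf (KK (Suc m) n) b"
    unfolding KK_Suc[OF step.hyps(2)] ab(1)
    using ab step by (intro pmf_conv_inj) (simp_all add: set_pmf_\<kappa> set_pmf_KK)
  moreover have "\<nu> n (f \<otimes> c) = \<nu> n (f \<otimes> a \<otimes> b)"
    using step ab car F_carrier C_carrier by (simp add: m_assoc subset_iff)
  ultimately show ?case
    using step.IH[of "f \<otimes> a" b] step.prems ab by (simp add: F_mult_C \<nu>_mult)
qed

section \<open>Representatives of points and the embeddings between levels\<close>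

lemma L_0: "s \<in> L n \<Longrightarrow> s 0 \<in> F n"
  and L_pos: "s \<in> L n \<Longrightarrow> i > 0 \<Longrightarrow> s i \<in> C (n + i)"
  by (simp_all add: mem_cf_level)

lemma L_carrier: "s \<in> L n \<Longrightarrow> s i \<in> carrier G"
  using L_0[of s n] L_pos[of s n i] F_carrier C_carrier[of "s i" "n + i - 1"] by (cases "i = 0") auto

lemma emb_0: "emb s 0 = s 0 \<otimes> s 1"
  and emb_pos: "i > 0 \<Longrightarrow> emb s i = s (Suc i)"
  by (simp_all add: cf_embed_def)

lemma emb_level: "s \<in> L n \<Longrightarrow> emb s \<in> L (Suc n)"
  using F_mult_C[of "s 0" n "s 1"] L_0[of s n] L_pos[of s n "Suc _"] L_pos[of s n 1]
  by (simp add: mem_cf_level[of _ S "Suc n"] cf_embed_def)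

lemma emb_pow_level: "s \<in> L n \<Longrightarrow> (emb ^^ j) s \<in> L (n + j)"
  by (induction j) (auto intro: emb_level)

lemma emb_inj: "s \<in> L n \<Longrightarrow> t \<in> L n \<Longrightarrow> emb s = emb t \<Longrightarrow> s = t"
proof
  fix i
  assume *: "s \<in> L n" "t \<in> L n" "emb s = emb t"
  have "s 0 \<otimes> s 1 = t 0 \<otimes> t 1"
    using fun_cong[OF *(3), of 0] by (simp add: cf_embed_def)
  then have "s 0 = t 0 \<and> s 1 = t 1"
    using * L_pos[of _ n 1] by (intro F_mult_C_inj) (auto simp: L_0)
  moreover have "s (Suc (Suc j)) = t (Suc (Suc j))" for j
    using fun_cong[OF *(3), of "Suc j"] by (simp add: cf_embed_def)
  ultimately show "s i = t i"
    by (metis One_nat_def not0_implies_Suc)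
qed

lemma emb_pow_inj: "s \<in> L n \<Longrightarrow> t \<in> L n \<Longrightarrow> (emb ^^ j) s = (emb ^^ j) t \<Longrightarrow> s = t"
proof (induction j)
  case (Suc j)
  then show ?case
    using emb_inj[OF emb_pow_level[OF Suc.prems(1), of j] emb_pow_level[OF Suc.prems(2), of j]] by simp
qed simp

lemma emb_pow_eq:
  assumes "\<And>i. s i \<in> carrier G"
  shows "(emb ^^ j) s = (\<lambda>i. if i = 0 then list_mult G (map s [0..<Suc j]) else s (i + j))"
proof (induction j)
  case 0
  show ?case by (rule ext) (simp add: assms)
next
  case (Suc j)
  have "map s [0..<Suc (Suc j)] = map s [0..<Suc j] @ [s (Suc j)]"
    by simp
  moreover have "set (map s [0..<Suc j]) \<subseteq> carrier G" "set [s (Suc j)] \<subseteq> carrier G"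
    using assms by auto
  ultimately have "list_mult G (map s [0..<Suc (Suc j)]) = list_mult G (map s [0..<Suc j]) \<otimes> s (Suc j)"
    using assms[of "Suc j"] by (simp only: list_mult_append list_mult_simps r_one)
  then have "emb ((emb ^^ j) s) i =
      (if i = 0 then list_mult G (map s [0..<Suc (Suc j)]) else s (i + Suc j))" for i
    by (cases "i = 0") (simp_all add: Suc emb_0 emb_pos del: upt_Suc)
  then show ?case by auto
qed

lemma pt_eq_iff:
  "s \<in> L n \<Longrightarrow> t \<in> L m \<Longrightarrow> pt n s = pt m t \<longleftrightarrow> ((n, s), (m, t)) \<in> cf_rel G S"
  unfolding cf_point_def by (rule eq_equiv_class_iff[OF equiv_cf_rel]) auto

lemma pt_in_X: "s \<in> L n \<Longrightarrow> pt n s \<in> X"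
  unfolding cf_point_def cf_space_def by (rule quotientI) auto

lemma pt_emb_pow: "s \<in> L n \<Longrightarrow> pt n s = pt (n + j) ((emb ^^ j) s)"
  by (subst pt_eq_iff) (auto simp: cf_rel_def emb_pow_level intro!: exI[of _ "n + j"])

lemma pt_emb: "s \<in> L n \<Longrightarrow> pt n s = pt (Suc n) (emb s)"
  using pt_emb_pow[of s n 1] by simp

lemma pt_inj: "s \<in> L n \<Longrightarrow> t \<in> L n \<Longrightarrow> pt n s = pt n t \<Longrightarrow> s = t"
  by (auto simp: pt_eq_iff cf_rel_def dest: emb_pow_inj)

lemma X_cases:
  assumes "x \<in> X"
  obtains n s where "s \<in> L n" "x = pt n s"
  using assms unfolding cf_space_def cf_point_def by (auto elim!: quotientE)

section \<open>Cylinders and their subdivision at later levels\<close>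

lemma cyl_iff: "x \<in> cyl n f \<longleftrightarrow> (\<exists>s\<in>L n. x = pt n s \<and> s 0 = f)"
  by (auto simp: cf_cylinder_def)

lemma cyl_sub_X: "cyl n f \<subseteq> X"
  by (auto simp: cyl_iff pt_in_X)

lemma cyl_inj: "x \<in> cyl n f \<Longrightarrow> x \<in> cyl n f' \<Longrightarrow> f = f'"
  by (auto simp: cyl_iff dest: pt_inj)

lemma cyl_F: "x \<in> cyl n f \<Longrightarrow> f \<in> F n"
  by (auto simp: cyl_iff L_0)

lemma cyl_split1:
  assumes "f \<in> F n"
  shows "cyl n f = (\<Union>c\<in>C (Suc n). cyl (Suc n) (f \<otimes> c))"
proof (intro equalityI subsetI)
  fix x assume "x \<in> cyl n f"
  then obtain s where s: "s \<in> L n" "x = pt n s" "s 0 = f" by (auto simp: cyl_iff)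
  then have "x \<in> cyl (Suc n) (f \<otimes> s 1)"
    using pt_emb[OF s(1)] emb_level[OF s(1)] by (auto simp: cyl_iff emb_0 intro!: bexI[of _ "emb s"])
  moreover have "s 1 \<in> C (Suc n)" using L_pos[OF s(1), of 1] by simp
  ultimately show "x \<in> (\<Union>c\<in>C (Suc n). cyl (Suc n) (f \<otimes> c))" by blast
next
  fix x assume "x \<in> (\<Union>c\<in>C (Suc n). cyl (Suc n) (f \<otimes> c))"
  then obtain c t where t: "c \<in> C (Suc n)" "t \<in> L (Suc n)" "x = pt (Suc n) t" "t 0 = f \<otimes> c"
    by (auto simp: cyl_iff)
  \<comment> \<open>Undo one embedding: the first coordinate \<open>f \<otimes> c\<close> of
    \<open>t\<close> is split back into the two coordinates \<open>f\<close> and \<open>c\<close>,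
    and the rest is shifted.\<close>
  define s where "s = (\<lambda>i. if i = 0 then f else if i = 1 then c else t (i - 1))"
  have "s i \<in> C (n + i)" if "i > 0" for i
  proof (cases "i = 1")
    case False
    then have "t (i - 1) \<in> C (Suc n + (i - 1))"
      using L_pos[OF t(2), of "i - 1"] that by simp
    then show ?thesis using that False by (simp add: s_def)
  qed (use t in \<open>simp add: s_def\<close>)
  then have "s \<in> L n"
    using assms by (simp add: mem_cf_level s_def)
  moreover have "emb s = t"
    using t by (auto simp: cf_embed_def s_def fun_eq_iff)
  moreover have "s 0 = f" by (simp add: s_def)
  ultimately show "x \<in> cyl n f"
    using t(3) pt_emb[of s n] by (auto simp only: cyl_iff)
qed

lemma cyl_split: "m \<le> n \<Longrightarrow> f \<in> F m \<Longrightarrow> cyl m f = (\<Union>c\<in>CC m n. cyl n (f \<otimes> c))"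
proof (induction arbitrary: f rule: inc_induct)
  case base
  then show ?case using F_carrier by simp
next
  case (step m)
  have car: "CC (Suc m) n \<subseteq> carrier G" using step CC_carrier by simp
  have "cyl m f = (\<Union>a\<in>C (Suc m). \<Union>b\<in>CC (Suc m) n. cyl n (f \<otimes> a \<otimes> b))"
    using step by (simp add: cyl_split1[of f m] F_mult_C)
  also have "\<dots> = (\<Union>a\<in>C (Suc m). \<Union>b\<in>CC (Suc m) n. cyl n (f \<otimes> (a \<otimes> b)))"
    using step.prems car C_carrier F_carrier by (intro SUP_cong refl) (auto simp: m_assoc subset_iff)
  also have "\<dots> = (\<Union>c\<in>CC m n. cyl n (f \<otimes> c))"
    using step by (auto simp: CC_Suc set_mult_def)
  finally show ?case .
qed

lemma cyl_levelE:
  assumes "x \<in> cyl m f" "m \<le> n"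
  obtains c where "c \<in> CC m n" "x \<in> cyl n (f \<otimes> c)"
  using assms cyl_split[OF assms(2) cyl_F[OF assms(1)]] by blast

lemma cyl_mult_sub: "m \<le> n \<Longrightarrow> f \<in> F m \<Longrightarrow> c \<in> CC m n \<Longrightarrow> cyl n (f \<otimes> c) \<subseteq> cyl m f"
  using cyl_split by blast

lemma X_cyl:
  assumes "x \<in> X"
  obtains m where "\<And>n. n \<ge> m \<Longrightarrow> \<exists>f\<in>F n. x \<in> cyl n f"
proof -
  obtain m s where "s \<in> L m" "x = pt m s" using assms by (rule X_cases)
  then have "x \<in> cyl m (s 0)" by (auto simp: cyl_iff)
  then show ?thesis
    using that[of m] by (metis cyl_levelE cyl_F)
qed

end

section \<open>Cylinders as a countable, intersection-stable base of the topology\<close>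

context cf_system
begin

text \<open>A product of \<open>j + 1\<close> coordinates determines each of them, so a cylinder
  \<open>j\<close> levels further up fixes the coordinates \<open>0\<close> to \<open>j\<close> of
  the level-\<open>n\<close> representative. The witness follows \<open>s\<close> up to
  \<open>j\<close> and \<open>t\<close> afterwards.\<close>

lemma cyl_refine:
  assumes "s \<in> L n" and y: "y \<in> cyl (n + j) ((emb ^^ j) s 0)"
  shows "\<exists>s'\<in>L n. (\<forall>i\<le>j. s' i = s i) \<and> y = pt n s'"
proof -
  obtain t where t: "t \<in> L (n + j)" "y = pt (n + j) t" "t 0 = (emb ^^ j) s 0"
    using y by (auto simp: cyl_iff)
  define s' where "s' = (\<lambda>i. if i \<le> j then s i else t (i - j))"
  have "s' i \<in> C (n + i)" if "i > 0" for i
    using that L_pos[OF assms(1), of i] L_pos[OF t(1), of "i - j"] by (auto simp: s'_def)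
  moreover have "s' 0 \<in> F n"
    using L_0[OF assms(1)] by (simp add: s'_def)
  ultimately have L: "s' \<in> L n"
    by (simp add: mem_cf_level)
  have "map s' [0..<Suc j] = map s [0..<Suc j]"
    by (auto simp: s'_def)
  then have "(emb ^^ j) s' = t"
    using t(3) emb_pow_eq[of s' j] emb_pow_eq[of s j] L_carrier[OF L] L_carrier[OF assms(1)]
    by (auto simp: fun_eq_iff s'_def simp del: upt_Suc map_eq_conv)
  then have "y = pt n s'"
    using pt_emb_pow[OF L, of j] t by simp
  then show "\<exists>s'\<in>L n. (\<forall>i\<le>j. s' i = s i) \<and> y = pt n s'"
    using L by (intro bexI[of _ s']) (auto simp: s'_def)
qed

text \<open>A basic open set of the product topology constrains finitely many coordinates, and a
  cylinder at a sufficiently late level fixes all of these.\<close>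

lemma open_contains_cyl:
  assumes U: "openin (cf_top G S) U" and x: "x \<in> U"
  shows "\<exists>k\<ge>m. \<exists>h\<in>F k. x \<in> cyl k h \<and> cyl k h \<subseteq> U"
proof -
  have "x \<in> X" using U x by (auto simp: openin_cf_top)
  then obtain n0 s0 where "s0 \<in> L n0" "x = pt n0 s0" by (rule X_cases)
  \<comment> \<open>Applying the embedding \<open>m\<close> times raises the representative to a
    level that is at least \<open>m\<close>.\<close>
  then obtain n s where s: "s \<in> L n" "x = pt n s" "m \<le> n"
    using pt_emb_pow[of s0 n0 m] emb_pow_level[of s0 n0 m] by auto
  have "openin (cf_level_top S n) {s \<in> L n. pt n s \<in> U}"
    using U by (simp add: openin_cf_top)
  moreover have "s \<in> {s \<in> L n. pt n s \<in> U}" using s x by simp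
  ultimately obtain V where V: "finite {i. V i \<noteq> topspace (discrete_topology (if i = 0 then F n else C (n + i)))}"
    "s \<in> Pi\<^sub>E UNIV V" "Pi\<^sub>E UNIV V \<subseteq> {s \<in> L n. pt n s \<in> U}"
    unfolding cf_level_top_def openin_product_topology_alt by auto
  obtain J where "\<forall>i\<in>{i. V i \<noteq> topspace (discrete_topology (if i = 0 then F n else C (n + i)))}. i < J"
    using V(1) finite_nat_set_iff_bounded by blast
  then have J: "V i = (if i = 0 then F n else C (n + i))" if "i > J" for i
    using that by force
  have "cyl (n + J) ((emb ^^ J) s 0) \<subseteq> U"
  proof
    fix y assume "y \<in> cyl (n + J) ((emb ^^ J) s 0)"
    then obtain s' where s': "s' \<in> L n" "\<And>i. i \<le> J \<Longrightarrow> s' i = s i" "y = pt n s'"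
      using cyl_refine[OF s(1)] by blast
    have "s' i \<in> V i" for i
    proof (cases "i \<le> J")
      case True
      then show ?thesis using s' V(2) by auto
    next
      case False
      then show ?thesis using s' J[of i] L_pos[of s' n i] by simp
    qed
    then have "s' \<in> Pi\<^sub>E UNIV V" by auto
    then show "y \<in> U" using V(3) s' by auto
  qed
  moreover have "x \<in> cyl (n + J) ((emb ^^ J) s 0)"
    using s pt_emb_pow[OF s(1), of J] emb_pow_level[OF s(1), of J] by (auto simp only: cyl_iff)
  ultimately show ?thesis
    using s(3) by (intro exI[of _ "n + J"] conjI bexI[of _ "(emb ^^ J) s 0"]) (auto intro: cyl_F)
qed

text \<open>The lower bound on the level permits a comparison of \<open>cyl m \<one>\<close> and
  \<open>cyl m f\<close> on cylinders of levels at which both are subdivided. The empty set is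
  included for closure under intersection.\<close>

definition cyls :: "nat \<Rightarrow> (nat \<times> (nat \<Rightarrow> 'a)) set set set" where
  "cyls m = insert {} {cyl k h |k h. m \<le> k \<and> h \<in> F k}"

lemma countable_cyls: "countable (cyls m)"
proof -
  have "countable (insert {} (\<Union>k. cyl k ` F k))"
    by (intro countable_insert countable_UN countable_image countable_finite finite_F countableI_type)
  moreover have "cyls m \<subseteq> insert {} (\<Union>k. cyl k ` F k)" by (auto simp: cyls_def)
  ultimately show ?thesis by (rule countable_subset[rotated])
qed

lemma cyls_sub: "cyls m \<subseteq> Pow X"
  using cyl_sub_X by (auto simp: cyls_def)

text \<open>Two cylinders are either disjoint or nested: a common point forces the label of the
  later one to extend the label of the earlier one.\<close>

lemma Int_stable_cyls: "Int_stable (cyls m)"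
proof (rule Int_stableI)
  have *: "cyl k h \<inter> cyl k' h' \<in> cyls m"
    if "m \<le> k" "k \<le> k'" "h \<in> F k" "h' \<in> F k'" for k h k' h'
  proof (cases "cyl k h \<inter> cyl k' h' = {}")
    case False
    then obtain x where x: "x \<in> cyl k h" "x \<in> cyl k' h'" by auto
    obtain c where c: "c \<in> CC k k'" "x \<in> cyl k' (h \<otimes> c)"
      using x(1) \<open>k \<le> k'\<close> by (rule cyl_levelE)
    then have "h' = h \<otimes> c" using x cyl_inj by blast
    then have "cyl k' h' \<subseteq> cyl k h" using c \<open>k \<le> k'\<close> \<open>h \<in> F k\<close> cyl_mult_sub by blast
    then have "cyl k h \<inter> cyl k' h' = cyl k' h'" by auto
    then show ?thesis using \<open>m \<le> k\<close> \<open>k \<le> k'\<close> \<open>h' \<in> F k'\<close> by (auto simp: cyls_def)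
  qed (simp add: cyls_def)
  fix A B assume "A \<in> cyls m" "B \<in> cyls m"
  then show "A \<inter> B \<in> cyls m"
    using * unfolding cyls_def by (smt (verit, ccfv_SIG) Int_commute Int_empty_left Int_empty_right
        insert_iff mem_Collect_eq nle_le)
qed

end

section \<open>The action\<close>

context cf_system
begin

text \<open>By associativity, left multiplication of the first coordinate commutes with the
  embeddings (\<open>upd\<close>). Two representatives of \<open>x\<close> therefore give the same
  image, which is the uniqueness that the description in \<open>cf_act\<close> needs.\<close>

lemma act_eq:
  assumes x: "x \<in> cf_total_dom G S" "x = pt n s" "s \<in> L n" and g: "g \<in> carrier G" "g \<otimes> s 0 \<in> F n"
  shows "cf_act G S g x = pt n (s(0 := g \<otimes> s 0))"
proof -
  have upd: "(emb ^^ j) (u(0 := g \<otimes> u 0)) = ((emb ^^ j) u)(0 := g \<otimes> (emb ^^ j) u 0)"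
    if "u \<in> L k" for u j k
  proof (induction j)
    case (Suc j)
    have "(emb ^^ j) u i \<in> carrier G" for i
      using L_carrier emb_pow_level[OF that] by blast
    moreover have "emb (v(0 := g \<otimes> v 0)) = (emb v)(0 := g \<otimes> emb v 0)"
      if "\<And>i. v i \<in> carrier G" for v
      using g that by (simp add: cf_embed_def fun_eq_iff m_assoc)
    ultimately show ?case by (simp only: funpow.simps o_apply Suc)
  qed simp
  have lev: "u(0 := g \<otimes> u 0) \<in> L k" if "u \<in> L k" "g \<otimes> u 0 \<in> F k" for u k
    using that by (auto simp: mem_cf_level)
  have eq: "y = pt n (s(0 := g \<otimes> s 0))"
    if "t \<in> L m" "x = pt m t" "g \<otimes> t 0 \<in> F m" "y = pt m (t(0 := g \<otimes> t 0))" for y m t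
  proof -
    have "((m, t), (n, s)) \<in> cf_rel G S"
      using that x pt_eq_iff by metis
    then obtain k where k: "m \<le> k" "n \<le> k" "(emb ^^ (k - m)) t = (emb ^^ (k - n)) s"
      by (auto simp: cf_rel_def)
    then have "(emb ^^ (k - m)) (t(0 := g \<otimes> t 0)) = (emb ^^ (k - n)) (s(0 := g \<otimes> s 0))"
      using upd that x by metis
    then have "((m, t(0 := g \<otimes> t 0)), (n, s(0 := g \<otimes> s 0))) \<in> cf_rel G S"
      using k lev that x g by (auto simp: cf_rel_def)
    then show ?thesis
      using that x g lev pt_eq_iff by metis
  qed
  show ?thesis
    unfolding cf_act_def if_P[OF x(1)]
  proof (rule the_equality)
    show "\<exists>m. \<exists>t\<in>L m. x = pt m t \<and> g \<otimes> t 0 \<in> F m \<and>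
        pt n (s(0 := g \<otimes> s 0)) = pt m (t(0 := g \<otimes> t 0))"
      using x g by blast
  next
    fix y
    assume "\<exists>m. \<exists>t\<in>L m. x = pt m t \<and> g \<otimes> t 0 \<in> F m \<and> y = pt m (t(0 := g \<otimes> t 0))"
    then obtain m t where "t \<in> L m" "x = pt m t" "g \<otimes> t 0 \<in> F m" "y = pt m (t(0 := g \<otimes> t 0))"
      by blast
    then show "y = pt n (s(0 := g \<otimes> s 0))" by (rule eq)
  qed
qed

lemma act_cyl:
  assumes "x \<in> cf_total_dom G S" "x \<in> cyl n h" "g \<in> carrier G" "g \<otimes> h \<in> F n"
  shows "cf_act G S g x \<in> cyl n (g \<otimes> h)"
proof -
  obtain s where s: "s \<in> L n" "x = pt n s" "s 0 = h" using assms by (auto simp: cyl_iff)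
  moreover from this have "s(0 := g \<otimes> h) \<in> L n" using assms by (auto simp: mem_cf_level)
  ultimately show ?thesis
    using act_eq[OF assms(1) s(2,1)] assms by (auto simp: cyl_iff)
qed

lemma dom_eq: "cf_dom G S g = (\<Union>n. \<Union>h\<in>{h \<in> F n. g \<otimes> h \<in> F n}. cyl n h)"
  unfolding cf_dom_def cf_cylinder_def using L_0 by fast

text \<open>If \<open>g \<otimes> h\<close> lies in \<open>F m\<close>, then appending a word
  \<open>c\<close> keeps \<open>g \<otimes> h \<otimes> c\<close> in the later sets
  \<open>F n\<close>; so \<open>g\<close> acts on the label of \<open>x\<close> at every level from
  \<open>m\<close> on.\<close>

lemma dom_cyl:
  assumes "x \<in> cf_dom G S g" "g \<in> carrier G"
  obtains m where "\<And>n. n \<ge> m \<Longrightarrow> \<exists>h\<in>F n. x \<in> cyl n h \<and> g \<otimes> h \<in> F n"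
proof -
  obtain m h where h: "h \<in> F m" "g \<otimes> h \<in> F m" "x \<in> cyl m h" using assms by (auto simp: dom_eq)
  have "\<exists>h\<in>F n. x \<in> cyl n h \<and> g \<otimes> h \<in> F n" if n: "n \<ge> m" for n
  proof -
    obtain c where c: "c \<in> CC m n" "x \<in> cyl n (h \<otimes> c)"
      using h(3) n by (rule cyl_levelE)
    then have "g \<otimes> h \<otimes> c \<in> F n" using F_mult_CC[OF n h(2)] by simp
    moreover have "c \<in> carrier G" using CC_carrier[OF n] c by auto
    ultimately show ?thesis
      using c h assms F_carrier cyl_F by (intro bexI[of _ "h \<otimes> c"]) (auto simp: m_assoc)
  qed
  then show ?thesis using that by blast
qed

lemma total_dom_sub: "cf_total_dom G S \<subseteq> X"
  unfolding cf_total_dom_def dom_eq using cyl_sub_X by blast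

end

section \<open>The measure\<close>

locale cf_measured = cf_system +
  fixes \<mu> :: "(nat \<times> (nat \<Rightarrow> 'a)) set measure"
  assumes meas: "cf_measure G S \<mu>"
begin

lemma space_\<mu>: "space \<mu> = X"
  using meas by (simp add: cf_measure_def)

lemma emeasure_cyl: "f \<in> F n \<Longrightarrow> emeasure \<mu> (cyl n f) = ennreal (\<nu> n f)"
  using meas by (simp add: cf_measure_def)

text \<open>Non-measurable sets have \<^const>\<open>emeasure\<close> 0, so positivity of \<open>\<nu>\<close> already gives measurability.\<close>

lemma cyl_sets [measurable]: "cyl n f \<in> sets \<mu>"
proof (cases "f \<in> F n")
  case True
  then have "emeasure \<mu> (cyl n f) \<noteq> 0" using \<nu>_pos[OF True] by (simp add: emeasure_cyl)
  then show ?thesis using emeasure_notin_sets by blast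
next
  case False
  then have "cyl n f = {}" using cyl_F by blast
  then show ?thesis by simp
qed

lemma measure_cyl: "f \<in> F n \<Longrightarrow> measure \<mu> (cyl n f) = \<nu> n f"
  using \<nu>_pos[of f n] by (simp add: measure_def emeasure_cyl)

lemma emeasure_cyl_finite [simp]: "emeasure \<mu> (cyl n f) < \<top>"
proof (cases "f \<in> F n")
  case False
  then have "cyl n f = {}" using cyl_F by blast
  then show ?thesis by simp
qed (simp add: emeasure_cyl)

text \<open>Every open set is the union of the cylinders of levels at least \<open>m\<close> that it
  contains, and there are only countably many cylinders. The choice of \<open>m\<close> is
  free.\<close>

lemma sets_\<mu>: "sets \<mu> = sigma_sets X (cyls m)"
proof
  have "sets \<mu> = sigma_sets X {U. openin (cf_top G S) U}"
    using meas by (simp add: cf_measure_def)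
  also have "\<dots> \<subseteq> sigma_sets X (cyls m)"
  proof (rule sigma_sets_mono, clarify)
    fix U assume U: "openin (cf_top G S) U"
    define \<V> where "\<V> = {A \<in> cyls m. A \<subseteq> U}"
    have "U = \<Union>\<V>"
    proof (intro equalityI subsetI)
      fix x assume "x \<in> U"
      then obtain k h where "k \<ge> m" "h \<in> F k" "x \<in> cyl k h" "cyl k h \<subseteq> U"
        using open_contains_cyl[OF U] by blast
      moreover from this have "cyl k h \<in> \<V>" by (auto simp: \<V>_def cyls_def)
      ultimately show "x \<in> \<Union>\<V>" by blast
    qed (auto simp: \<V>_def)
    moreover have "\<Union>\<V> \<in> sigma_sets X (cyls m)"
      unfolding \<V>_def
      by (intro sigma_sets_UNION countable_subset[OF _ countable_cyls[of m]]) auto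
    ultimately show "U \<in> sigma_sets X (cyls m)" by simp
  qed
  finally show "sets \<mu> \<subseteq> sigma_sets X (cyls m)" .
  have "cyls m \<subseteq> sets \<mu>" by (auto simp: cyls_def)
  then show "sigma_sets X (cyls m) \<subseteq> sets \<mu>"
    using sets.sigma_sets_subset[of "cyls m" \<mu>] by (simp add: space_\<mu>)
qed

lemma emeasure_UN_cyl_finite [simp]: "D \<subseteq> F n \<Longrightarrow> emeasure \<mu> (\<Union>f\<in>D. cyl n f) < \<top>"
  using finite_subset[OF _ finite_F, of D n]
  by (intro le_less_trans[OF emeasure_subadditive_finite]) auto

lemma fmeasurable_UN_cyl: "D \<subseteq> F n \<Longrightarrow> (\<Union>f\<in>D. cyl n f) \<in> fmeasurable \<mu>"
  using finite_subset[OF _ finite_F, of D n]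
  by (intro fmeasurableI emeasure_UN_cyl_finite) auto

lemma fmeasurable_cyl: "cyl n f \<in> fmeasurable \<mu>"
  by (intro fmeasurableI) auto

lemma disjoint_cyl: "inj_on u D \<Longrightarrow> disjoint_family_on (\<lambda>f. cyl n (u f)) D"
  unfolding disjoint_family_on_def using cyl_inj by (blast dest: inj_onD)

lemma measure_UN_cyl:
  assumes "D \<subseteq> F n" shows "measure \<mu> (\<Union>f\<in>D. cyl n f) = (\<Sum>f\<in>D. \<nu> n f)"
proof -
  have "finite D" using assms finite_subset finite_F by blast
  then have "measure \<mu> (\<Union>f\<in>D. cyl n f) = (\<Sum>f\<in>D. measure \<mu> (cyl n f))"
    using disjoint_cyl[of "\<lambda>x. x" D n] emeasure_cyl_finite[of n]
    by (intro measure_finite_Union) (auto simp: less_top[symmetric])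
  also have "\<dots> = (\<Sum>f\<in>D. \<nu> n f)" using assms by (intro sum.cong) (auto simp: measure_cyl)
  finally show ?thesis .
qed

section \<open>Admissibility and the total domain of the action\<close>

lemma dom_sets [measurable]: "cf_dom G S g \<in> sets \<mu>"
  unfolding dom_eq by (intro sets.countable_UN'' sets.finite_UN) auto

text \<open>Fix a level \<open>n\<close>. The sum in the admissibility condition is the measure of a
  part \<open>W m\<close> of level \<open>n\<close> lying inside the domain of \<open>g\<close>, and
  it tends to the whole finite mass of level \<open>n\<close>. Hence level \<open>n\<close> minus
  the domain is null, and \<open>X\<close> is the union of countably many levels.\<close>

lemma AE_dom:
  assumes adm: "cf_admissible G S" and g: "g \<in> carrier G"
  shows "AE x in \<mu>. x \<in> cf_dom G S g"
proof -
  let ?U = "\<lambda>n. \<Union>f\<in>F n. cyl n f"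
  have "?U n - cf_dom G S g \<in> null_sets \<mu>" for n
  proof -
    \<comment> \<open>\<open>D m\<close> collects the labels at level \<open>m\<close> that come
      from level \<open>n\<close> and stay in \<open>F m\<close> under multiplication by
      \<open>g\<close>.\<close>
    define D where "D m = (F n <#> CC n m) \<inter> (inv g <# F m)" for m
    define W where "W m = (\<Union>h\<in>D m. cyl m h)" for m
    have U: "?U n \<in> fmeasurable \<mu>" by (simp add: fmeasurable_UN_cyl)
    then have Ud: "?U n \<inter> cf_dom G S g \<in> fmeasurable \<mu>" by (simp add: fmeasurable_Int_fmeasurable)
    have DF: "D m \<subseteq> F m" if "n \<le> m" for m
      using that F_mult_CC unfolding D_def set_mult_def by blast
    have "measure \<mu> (W m) \<le> measure \<mu> (?U n \<inter> cf_dom G S g)" if m: "n \<le> m" for m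
    proof (rule measure_mono_fmeasurable[OF _ _ Ud])
      show "W m \<in> sets \<mu>"
        using fmeasurable_UN_cyl[OF DF[OF m]] unfolding W_def by blast
      show "W m \<subseteq> ?U n \<inter> cf_dom G S g"
      proof
        fix x assume "x \<in> W m"
        then obtain h where h: "h \<in> D m" "x \<in> cyl m h" by (auto simp: W_def)
        then have "x \<in> ?U n" using m cyl_mult_sub by (fastforce simp: D_def set_mult_def)
        moreover obtain f where "f \<in> F m" "h = inv g \<otimes> f" using h by (auto simp: D_def l_coset_def)
        then have "g \<otimes> h \<in> F m" using g F_carrier by (simp add: m_assoc[symmetric])
        then have "x \<in> cf_dom G S g" using h DF[OF m] by (auto simp: dom_eq)
        ultimately show "x \<in> ?U n \<inter> cf_dom G S g" by simp
      qed
    qed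
    moreover have "measure \<mu> (W m) = (\<Sum>f\<in>D m. \<nu> m f)" if "n \<le> m" for m
      unfolding W_def using DF[OF that] by (rule measure_UN_cyl)
    moreover have "(\<lambda>m. \<Sum>f\<in>D m. \<nu> m f) \<longlonglongrightarrow> measure \<mu> (?U n)"
      using adm g unfolding cf_admissible_def D_def CC_def by (subst measure_UN_cyl) auto
    ultimately have "measure \<mu> (?U n) \<le> measure \<mu> (?U n \<inter> cf_dom G S g)"
      by (intro LIMSEQ_le_const2[of "\<lambda>m. \<Sum>f\<in>D m. \<nu> m f"]) (auto intro!: exI[of _ n])
    moreover have "measure \<mu> (?U n - cf_dom G S g) = measure \<mu> (?U n) - measure \<mu> (?U n \<inter> cf_dom G S g)"
      using measure_Diff[of \<mu> "?U n" "?U n \<inter> cf_dom G S g"] U Ud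
      by (auto simp: Diff_Int fmeasurableD fmeasurableD2)
    ultimately have "measure \<mu> (?U n - cf_dom G S g) = 0"
      using measure_nonneg[of \<mu> "?U n - cf_dom G S g"] by linarith
    moreover have "?U n - cf_dom G S g \<in> fmeasurable \<mu>" using U by (intro fmeasurable_Diff) auto
    ultimately show ?thesis
      using emeasure_eq_measure2[of "?U n - cf_dom G S g" \<mu>] by (auto simp: fmeasurableD)
  qed
  then have "(\<Union>n. ?U n - cf_dom G S g) \<in> null_sets \<mu>" by blast
  then show ?thesis
  proof (rule AE_I')
    show "{x \<in> space \<mu>. x \<notin> cf_dom G S g} \<subseteq> (\<Union>n. ?U n - cf_dom G S g)"
    proof
      fix x assume x: "x \<in> {x \<in> space \<mu>. x \<notin> cf_dom G S g}"
      then have "x \<in> X" using space_\<mu> by simp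
      then obtain n where "\<And>k. k \<ge> n \<Longrightarrow> \<exists>f\<in>F k. x \<in> cyl k f" by (rule X_cyl) blast
      then have "\<exists>f\<in>F n. x \<in> cyl n f" by simp
      then show "x \<in> (\<Union>n. ?U n - cf_dom G S g)" using x by auto
    qed
  qed
qed

lemma total_dom_sets [measurable]: "countable (carrier G) \<Longrightarrow> cf_total_dom G S \<in> sets \<mu>"
  unfolding cf_total_dom_def by (rule sets.countable_INT') (auto intro: dom_sets)

lemma AE_total_dom:
  assumes "countable (carrier G)" "cf_admissible G S"
  shows "AE x in \<mu>. x \<in> cf_total_dom G S"
  using AE_dom[OF assms(2)] assms(1) unfolding cf_total_dom_def by (simp add: AE_ball_countable)

text \<open>\<open>T_f\<close> carries the cylinder of a word \<open>c\<close> inside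
  \<open>cyl m \<one>\<close> to the cylinder of \<open>f \<otimes> c\<close> inside
  \<open>cyl m f\<close>. Their masses are \<open>\<nu> m \<one>\<close> and
  \<open>\<nu> m f\<close> times the same probability of \<open>c\<close>, so the ratio is constant
  on cylinders and then on all measurable sets. The identity is cross-multiplied to avoid division
  in \<open>ennreal\<close>.\<close>

lemma emeasure_vimage_act:
  assumes cnt: "countable (carrier G)" and adm: "cf_admissible G S"
    and f: "f \<in> F m" and B: "B \<in> sets \<mu>"
  shows "ennreal (\<nu> m f) * emeasure \<mu> (cf_total_dom G S \<inter> cyl m \<one> \<inter> cf_act G S f -` B) =
      ennreal (\<nu> m \<one>) * emeasure \<mu> (cyl m f \<inter> B)"
    and "cf_total_dom G S \<inter> cyl m \<one> \<inter> cf_act G S f -` B \<in> sets \<mu>"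
proof -
  define P where "P = cf_total_dom G S \<inter> cyl m \<one>"
  let ?T = "cf_act G S f"
  have P: "P \<in> sets \<mu>" using total_dom_sets[OF cnt] by (simp add: P_def)
  have fc: "f \<in> carrier G" using f by (rule F_carrier)
  \<comment> \<open>On \<open>P\<close> the label at level \<open>k\<close> is a word
    \<open>c\<close>, and the action turns it into \<open>f \<otimes> c\<close>; so preimages of
    cylinders are finite unions of cylinders within \<open>P\<close>.\<close>
  have vim: "P \<inter> ?T -` cyl k h = P \<inter> (\<Union>c\<in>{c \<in> CC m k. f \<otimes> c = h}. cyl k c)"
    if k: "m \<le> k" for k h
  proof (intro equalityI subsetI)
    fix x assume x: "x \<in> P \<inter> ?T -` cyl k h"
    then have "x \<in> cyl m \<one>" by (simp add: P_def)
    then obtain c where c: "c \<in> CC m k" "x \<in> cyl k (\<one> \<otimes> c)"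
      using k by (rule cyl_levelE)
    moreover have "c \<in> carrier G" using c CC_carrier[OF k] by blast
    ultimately have "x \<in> cyl k c" by simp
    then have "?T x \<in> cyl k (f \<otimes> c)"
      using x F_mult_CC[OF k f c(1)] fc by (intro act_cyl) (auto simp: P_def)
    then have "f \<otimes> c = h" using x cyl_inj by blast
    then show "x \<in> P \<inter> (\<Union>c\<in>{c \<in> CC m k. f \<otimes> c = h}. cyl k c)"
      using x c \<open>x \<in> cyl k c\<close> by blast
  next
    fix x assume "x \<in> P \<inter> (\<Union>c\<in>{c \<in> CC m k. f \<otimes> c = h}. cyl k c)"
    then obtain c where c: "x \<in> P" "c \<in> CC m k" "h = f \<otimes> c" "x \<in> cyl k c" by blast
    then show "x \<in> P \<inter> ?T -` cyl k h"
      using act_cyl[of x k c f] F_mult_CC[OF k f, of c] fc by (auto simp: P_def)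
  qed
  have T: "?T \<in> measurable (restrict_space \<mu> P) \<mu>"
  proof (rule measurable_sigma_sets[OF sets_\<mu>[of m] cyls_sub])
    show "?T \<in> space (restrict_space \<mu> P) \<rightarrow> X"
    proof
      fix x assume "x \<in> space (restrict_space \<mu> P)"
      then have "x \<in> cf_total_dom G S" "x \<in> cyl m \<one>"
        by (auto simp: space_restrict_space P_def)
      then have "?T x \<in> cyl m (f \<otimes> \<one>)" using f fc by (intro act_cyl) auto
      then show "?T x \<in> X" using cyl_sub_X by blast
    qed
    fix A assume "A \<in> cyls m"
    then consider "A = {}" | k h where "m \<le> k" "A = cyl k h" by (auto simp: cyls_def)
    then show "?T -` A \<inter> space (restrict_space \<mu> P) \<in> sets (restrict_space \<mu> P)"
    proof cases
      case 2
      have "finite {c \<in> CC m k. f \<otimes> c = h}" using finite_CC[OF 2(1)] by simp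
      then have "P \<inter> (\<Union>c\<in>{c \<in> CC m k. f \<otimes> c = h}. cyl k c) \<in> sets \<mu>"
        using P by (intro sets.Int sets.finite_UN cyl_sets)
      then show ?thesis
        using vim[OF 2(1), of h] P 2(2)
        by (simp add: space_restrict_space2 sets_restrict_space_iff Int_commute)
    qed simp
  qed
  \<comment> \<open>The two sides of the claim, read as measures in the variable
    \<open>B\<close>.\<close>
  define N1 where "N1 = scale_measure (ennreal (\<nu> m f)) (distr (restrict_space \<mu> P) \<mu> ?T)"
  define N2 where "N2 = density \<mu> (\<lambda>x. ennreal (\<nu> m \<one>) * indicator (cyl m f) x)"
  have PB: "P \<inter> ?T -` B \<in> sets \<mu>" if "B \<in> sets \<mu>" for B
    using measurable_sets[OF T that] P
    by (simp add: space_restrict_space2 sets_restrict_space_iff Int_commute)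
  have e1: "emeasure N1 B = ennreal (\<nu> m f) * emeasure \<mu> (P \<inter> ?T -` B)" if "B \<in> sets \<mu>" for B
    using that P T PB[OF that] unfolding N1_def
    by (simp add: emeasure_distr space_restrict_space2 emeasure_restrict_space Int_commute)
  have e2: "emeasure N2 B = ennreal (\<nu> m \<one>) * emeasure \<mu> (cyl m f \<inter> B)" if "B \<in> sets \<mu>" for B
  proof -
    have "emeasure N2 B = (\<integral>\<^sup>+x. ennreal (\<nu> m \<one>) * indicator (cyl m f \<inter> B) x \<partial>\<mu>)"
      using that unfolding N2_def
      by (subst emeasure_density) (auto intro!: nn_integral_cong simp: indicator_def)
    also have "\<dots> = ennreal (\<nu> m \<one>) * emeasure \<mu> (cyl m f \<inter> B)"
      using that by (intro nn_integral_cmult_indicator) auto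
    finally show ?thesis .
  qed
  \<comment> \<open>Uniqueness of measures on the generator \<open>cyls m\<close>, which is itself a
    countable cover of \<open>X\<close> by sets of finite measure.\<close>
  have "N1 = N2"
  proof (rule measure_eqI_generator_eq_countable[OF Int_stable_cyls[of m] cyls_sub, where A = "cyls m"])
    show "sets N1 = sigma_sets X (cyls m)" "sets N2 = sigma_sets X (cyls m)"
      unfolding N1_def N2_def by (simp_all add: sets_\<mu>[of m])
    show "\<Union> (cyls m) = X"
    proof
      show "\<Union> (cyls m) \<subseteq> X" using cyls_sub by blast
      show "X \<subseteq> \<Union> (cyls m)"
      proof
        fix x assume "x \<in> X"
        then obtain n where n: "\<And>k. k \<ge> n \<Longrightarrow> \<exists>h\<in>F k. x \<in> cyl k h" by (rule X_cyl) blast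
        obtain h where "h \<in> F (max m n)" "x \<in> cyl (max m n) h" using n[of "max m n"] by auto
        moreover from this have "cyl (max m n) h \<in> cyls m" unfolding cyls_def by force
        ultimately show "x \<in> \<Union> (cyls m)" by blast
      qed
    qed
    show "emeasure N1 A = emeasure N2 A" if A: "A \<in> cyls m" for A
    proof -
      consider "A = {}" | k h where "m \<le> k" "A = cyl k h" "h \<in> F k"
        using A by (auto simp: cyls_def)
      then show ?thesis
      proof cases
        case (2 k h)
        \<comment> \<open>Either the cylinder of \<open>h\<close> lies inside
          \<open>cyl m f\<close>, and both sides are computed from the word \<open>c\<close>, or it
          is disjoint from \<open>cyl m f\<close>, and both sides vanish.\<close>
        show ?thesis
        proof (cases "\<exists>c\<in>CC m k. f \<otimes> c = h")
          case True
          then obtain c where c: "c \<in> CC m k" "f \<otimes> c = h" by blast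
          have car: "CC m k \<subseteq> carrier G" using 2 CC_carrier by simp
          have "{c \<in> CC m k. f \<otimes> c = h} = {c}"
            using c car fc by (auto simp: subset_iff)
          moreover have sub: "cyl k c \<subseteq> cyl m \<one>"
            using cyl_mult_sub[OF 2(1) one_F c(1)] car c(1) by (auto simp: subset_iff)
          ultimately have "P \<inter> ?T -` A = cf_total_dom G S \<inter> cyl k c"
            using vim[OF 2(1), of h] 2(2) by (auto simp: P_def)
          moreover have "emeasure \<mu> (cf_total_dom G S \<inter> cyl k c) = emeasure \<mu> (cyl k c)"
            using AE_total_dom[OF cnt adm] total_dom_sets[OF cnt] by (intro emeasure_eq_AE) auto
          moreover have "c \<in> F k" using F_mult_CC[OF 2(1) one_F c(1)] car c(1) by (auto simp: subset_iff)
          moreover have "\<nu> k c = \<nu> m \<one> * pmf (KK m k) c"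
            using \<nu>_mult_CC[OF 2(1) one_F c(1)] car c(1) by (auto simp: subset_iff)
          moreover have "\<nu> k h = \<nu> m f * pmf (KK m k) c"
            using \<nu>_mult_CC[OF 2(1) f c(1)] c(2) by simp
          moreover have "cyl m f \<inter> A = A"
            using cyl_mult_sub[OF 2(1) f c(1)] c(2) 2(2) by auto
          ultimately show ?thesis
            using 2 e1[of A] e2[of A] \<nu>_pos[OF f] \<nu>_pos[of \<one> m]
            by (simp add: emeasure_cyl ennreal_mult'[symmetric] mult_ac)
        next
          case False
          have "P \<inter> ?T -` A = {}" using vim[OF 2(1), of h] False 2(2) by auto
          moreover have "cyl m f \<inter> A = {}"
          proof (rule ccontr)
            assume "cyl m f \<inter> A \<noteq> {}"
            then obtain x where x: "x \<in> cyl m f" "x \<in> cyl k h" using 2(2) by auto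
            obtain c where "c \<in> CC m k" "x \<in> cyl k (f \<otimes> c)" using x(1) 2(1) by (rule cyl_levelE)
            then show False using False x(2) cyl_inj by blast
          qed
          ultimately show ?thesis using 2 e1[of A] e2[of A] by simp
        qed
      qed simp
    qed
    show "emeasure N1 A \<noteq> \<infinity>" if "A \<in> cyls m" for A
    proof -
      have A: "A \<in> sets \<mu>" using that by (auto simp: cyls_def)
      have "emeasure \<mu> (P \<inter> ?T -` A) \<le> emeasure \<mu> (cyl m \<one>)"
        by (intro emeasure_mono) (auto simp: P_def)
      also have "\<dots> < \<top>" by simp
      finally show ?thesis using e1[OF A] by (simp add: ennreal_mult_eq_top_iff)
    qed
  qed (auto simp: countable_cyls)
  then show "ennreal (\<nu> m f) * emeasure \<mu> (cf_total_dom G S \<inter> cyl m \<one> \<inter> ?T -` B) =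
      ennreal (\<nu> m \<one>) * emeasure \<mu> (cyl m f \<inter> B)"
    using e1[OF B] e2[OF B] by (simp add: P_def)
  show "cf_total_dom G S \<inter> cyl m \<one> \<inter> ?T -` B \<in> sets \<mu>"
    using PB[OF B] by (simp add: P_def)
qed

section \<open>The ring of finite unions of cylinders and approximation by its members\<close>

definition cyl_ring :: "(nat \<times> (nat \<Rightarrow> 'a)) set set set" where
  "cyl_ring = {A. \<exists>n D. D \<subseteq> F n \<and> A = (\<Union>f\<in>D. cyl n f)}"

text \<open>Refinement to a later level brings any two members of \<open>cyl_ring\<close> to a
  common level, where union and difference become operations on finite sets of labels.\<close>

lemma cyl_ring_level:
  assumes "D \<subseteq> F m" "m \<le> n"
  shows "\<exists>D'\<subseteq>F n. (\<Union>f\<in>D. cyl m f) = (\<Union>f\<in>D'. cyl n f)"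
proof (intro exI[of _ "D <#> CC m n"] conjI)
  show "D <#> CC m n \<subseteq> F n"
    using assms F_mult_CC unfolding set_mult_def by blast
  have "(\<Union>f\<in>D. cyl m f) = (\<Union>f\<in>D. \<Union>c\<in>CC m n. cyl n (f \<otimes> c))"
    using assms by (intro SUP_cong refl cyl_split) auto
  then show "(\<Union>f\<in>D. cyl m f) = (\<Union>f\<in>D <#> CC m n. cyl n f)"
    by (simp add: set_mult_def)
qed

lemma cyl_ringE:
  assumes "A \<in> cyl_ring" "B \<in> cyl_ring"
  obtains n D E where "D \<subseteq> F n" "E \<subseteq> F n" "A = (\<Union>f\<in>D. cyl n f)" "B = (\<Union>f\<in>E. cyl n f)"
proof -
  obtain m D where D: "D \<subseteq> F m" "A = (\<Union>f\<in>D. cyl m f)" using assms by (auto simp: cyl_ring_def)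
  obtain k E where E: "E \<subseteq> F k" "B = (\<Union>f\<in>E. cyl k f)" using assms by (auto simp: cyl_ring_def)
  obtain D' where "D' \<subseteq> F (max m k)" "A = (\<Union>f\<in>D'. cyl (max m k) f)"
    using cyl_ring_level[OF D(1), of "max m k"] D(2) by auto
  moreover obtain E' where "E' \<subseteq> F (max m k)" "B = (\<Union>f\<in>E'. cyl (max m k) f)"
    using cyl_ring_level[OF E(1), of "max m k"] E(2) by auto
  ultimately show ?thesis using that by blast
qed

lemma cyl_ring_Un: 
  assumes "A \<in> cyl_ring" "B \<in> cyl_ring" shows "A \<union> B \<in> cyl_ring"
proof -
  obtain n D E where "D \<subseteq> F n" "E \<subseteq> F n" "A = (\<Union>f\<in>D. cyl n f)" "B = (\<Union>f\<in>E. cyl n f)"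
    using assms by (rule cyl_ringE)
  then show ?thesis unfolding cyl_ring_def by (auto intro!: exI[of _ n] exI[of _ "D \<union> E"])
qed

lemma cyl_ring_Diff: 
  assumes "A \<in> cyl_ring" "B \<in> cyl_ring" shows "A - B \<in> cyl_ring"
proof -
  obtain n D E where *: "D \<subseteq> F n" "E \<subseteq> F n" "A = (\<Union>f\<in>D. cyl n f)" "B = (\<Union>f\<in>E. cyl n f)"
    using assms by (rule cyl_ringE)
  then have "A - B = (\<Union>f\<in>D - E. cyl n f)" using cyl_inj by blast
  then show ?thesis unfolding cyl_ring_def using * by (auto intro!: exI[of _ n] exI[of _ "D - E"])
qed

lemma cyl_ring_cyl: "f \<in> F n \<Longrightarrow> cyl n f \<in> cyl_ring"
  unfolding cyl_ring_def by (auto intro!: exI[of _ n] exI[of _ "{f}"])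

lemma cyl_ring_empty: "{} \<in> cyl_ring"
  unfolding cyl_ring_def by (auto intro!: exI[of _ "{}"])

lemma cyl_ring_UN: "finite I \<Longrightarrow> (\<And>i. i \<in> I \<Longrightarrow> A i \<in> cyl_ring) \<Longrightarrow> (\<Union>i\<in>I. A i) \<in> cyl_ring"
  by (induction rule: finite_induct) (auto intro: cyl_ring_Un cyl_ring_empty)

lemma cyl_ring_fmeasurable: "A \<in> cyl_ring \<Longrightarrow> A \<in> fmeasurable \<mu>"
  by (auto simp: cyl_ring_def intro: fmeasurable_UN_cyl)

lemma fmeasurable_Int_cyl: "A \<in> sets \<mu> \<Longrightarrow> A \<inter> cyl n f \<in> fmeasurable \<mu>"
  using fmeasurable_Int_fmeasurable[OF fmeasurable_cyl, of A n f] by (simp add: Int_commute)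

text \<open>The usual approximation by a generating ring, by induction over the generated
  sigma-algebra. The set is cut down to \<open>cyl 0 \<one>\<close> because \<open>\<mu>\<close> may
  be infinite, whereas continuity from above in the union case needs finite measure.\<close>

lemma approx_by_cyl_ring:
  assumes "B \<in> sets \<mu>" "\<delta> > 0"
  shows "\<exists>W\<in>cyl_ring. measure \<mu> (sym_diff (B \<inter> cyl 0 \<one>) W) < \<delta>"
proof -
  have "B \<in> sigma_sets X (cyls 0)" using assms sets_\<mu> by simp
  then show ?thesis using assms(2)
  proof (induction arbitrary: \<delta> rule: sigma_sets.induct)
    case (Basic A)
    have "cyl 0 \<one> \<in> cyls 0" using one_F[of 0] unfolding cyls_def by blast
    then have "A \<inter> cyl 0 \<one> \<in> cyls 0" using Basic Int_stable_cyls by (auto simp: Int_stable_def)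
    then have "A \<inter> cyl 0 \<one> \<in> cyl_ring"
      using cyl_ring_cyl cyl_ring_empty by (auto simp: cyls_def)
    then show ?case using Basic.prems by (intro bexI[of _ "A \<inter> cyl 0 \<one>"]) auto
  next
    case Empty
    then show ?case using cyl_ring_empty by (intro bexI[of _ "{}"]) auto
  next
    case (Compl A)
    then obtain W where W: "W \<in> cyl_ring" "measure \<mu> (sym_diff (A \<inter> cyl 0 \<one>) W) < \<delta>" by blast
    have A: "A \<in> sets \<mu>" using Compl sets_\<mu> by simp
    \<comment> \<open>Complements are taken relative to \<open>cyl 0 \<one>\<close>. Only an
      inclusion of symmetric differences holds, since \<open>W\<close> may stick out of
      \<open>cyl 0 \<one>\<close>.\<close>
    have "measure \<mu> (sym_diff ((X - A) \<inter> cyl 0 \<one>) (cyl 0 \<one> - W)) \<le>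
        measure \<mu> (sym_diff (A \<inter> cyl 0 \<one>) W)"
    proof (rule measure_mono_fmeasurable)
      show "sym_diff ((X - A) \<inter> cyl 0 \<one>) (cyl 0 \<one> - W) \<subseteq> sym_diff (A \<inter> cyl 0 \<one>) W"
        using cyl_sub_X by blast
      have "X \<in> sets \<mu>" using sets.top[of \<mu>] space_\<mu> by simp
      then show "sym_diff ((X - A) \<inter> cyl 0 \<one>) (cyl 0 \<one> - W) \<in> sets \<mu>"
        using A cyl_ring_fmeasurable[OF W(1)] by (intro sets.Un sets.Diff sets.Int) auto
      show "sym_diff (A \<inter> cyl 0 \<one>) W \<in> fmeasurable \<mu>"
        using fmeasurable_Int_cyl[OF A] cyl_ring_fmeasurable[OF W(1)]
        by (intro fmeasurable.Un fmeasurable.Diff) auto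
    qed
    then show ?case
      using W cyl_ring_Diff[OF cyl_ring_cyl[OF one_F] W(1), of 0] by (intro bexI[of _ "cyl 0 \<one> - W"]) auto
  next
    case (Union A)
    let ?B = "\<lambda>i. A i \<inter> cyl 0 \<one>"
    have A: "A i \<in> sets \<mu>" for i using Union.hyps sets_\<mu> by simp
    \<comment> \<open>The tail missed by the first \<open>N\<close> sets. It decreases to the empty
      set and receives one half of \<open>\<delta>\<close>; the other half is shared by the
      \<open>N\<close> approximations, with \<open>N + 1\<close> in the denominator to cover
      \<open>N = 0\<close>.\<close>
    define R where "R N = (\<Union>i. ?B i) - (\<Union>i<N. ?B i)" for N
    have fin: "(\<Union>i. ?B i) \<in> fmeasurable \<mu>"
    proof -
      have "cyl 0 \<one> \<inter> (\<Union>i. A i) \<in> fmeasurable \<mu>"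
        using A by (intro fmeasurable_Int_fmeasurable fmeasurable_cyl) auto
      then show ?thesis by (simp add: Int_commute)
    qed
    have Bs: "?B i \<in> sets \<mu>" for i using A by auto
    then have R: "R N \<in> fmeasurable \<mu>" for N
      unfolding R_def using fin Bs by (intro fmeasurable_Diff sets.finite_UN) auto
    have "(\<lambda>N. measure \<mu> (R N)) \<longlonglongrightarrow> measure \<mu> (\<Inter>N. R N)"
    proof (rule Lim_measure_decseq)
      show "decseq R"
        unfolding decseq_def R_def by (intro allI impI Diff_mono UN_mono) auto
    qed (use R in \<open>auto simp: fmeasurableD2\<close>)
    moreover have "(\<Inter>N. R N) = {}" by (auto simp: R_def)
    ultimately have "(\<lambda>N. measure \<mu> (R N)) \<longlonglongrightarrow> 0" by simp
    then have "\<forall>\<^sub>F N in sequentially. measure \<mu> (R N) < \<delta> / 2"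
      using Union.prems by (intro order_tendstoD(2)) auto
    then obtain N where N: "measure \<mu> (R N) < \<delta> / 2"
      by (auto simp: eventually_sequentially)
    have "\<exists>W\<in>cyl_ring. measure \<mu> (sym_diff (?B i) W) < \<delta> / (2 * (N + 1))" for i
      using Union.prems by (intro Union.IH) auto
    then obtain W where W: "\<And>i. W i \<in> cyl_ring"
      "\<And>i. measure \<mu> (sym_diff (?B i) (W i)) < \<delta> / (2 * (N + 1))" by metis
    have Ws: "W i \<in> sets \<mu>" for i using cyl_ring_fmeasurable[OF W(1)] by auto
    have sd: "sym_diff (?B i) (W i) \<in> fmeasurable \<mu>" for i
      using fmeasurable_Int_cyl[OF A[of i]] cyl_ring_fmeasurable[OF W(1)[of i]]
      by (intro fmeasurable.Un fmeasurable.Diff) auto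
    let ?W = "\<Union>i<N. W i"
    have "measure \<mu> (sym_diff (\<Union>(range A) \<inter> cyl 0 \<one>) ?W) \<le>
        measure \<mu> (R N \<union> (\<Union>i<N. sym_diff (?B i) (W i)))"
    proof (rule measure_mono_fmeasurable)
      show "sym_diff (\<Union>(range A) \<inter> cyl 0 \<one>) ?W \<subseteq> R N \<union> (\<Union>i<N. sym_diff (?B i) (W i))"
        by (auto simp: R_def)
      show "sym_diff (\<Union>(range A) \<inter> cyl 0 \<one>) ?W \<in> sets \<mu>"
        using A Ws by (intro sets.Un sets.Diff sets.Int sets.countable_UN sets.finite_UN) auto
      show "R N \<union> (\<Union>i<N. sym_diff (?B i) (W i)) \<in> fmeasurable \<mu>"
        by (intro fmeasurable.Un[OF R] fmeasurable.finite_UN finite_lessThan sd)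
    qed
    also have "\<dots> \<le> measure \<mu> (R N) + measure \<mu> (\<Union>i<N. sym_diff (?B i) (W i))"
      by (intro measure_Un_le sets.finite_UN finite_lessThan fmeasurableD[OF sd] fmeasurableD[OF R])
    also have "measure \<mu> (\<Union>i<N. sym_diff (?B i) (W i)) \<le> (\<Sum>i<N. measure \<mu> (sym_diff (?B i) (W i)))"
      by (intro measure_UNION_le finite_lessThan fmeasurableD[OF sd])
    also have "\<dots> \<le> (\<Sum>i<N. \<delta> / (2 * (N + 1)))"
      using W by (intro sum_mono) (simp add: less_imp_le)
    also have "\<dots> \<le> \<delta> / 2"
      using Union.prems by (simp add: field_simps)
    finally have "measure \<mu> (sym_diff (\<Union>(range A) \<inter> cyl 0 \<one>) ?W) < \<delta>" using N by simp
    moreover have "?W \<in> cyl_ring" using W by (intro cyl_ring_UN) auto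
    ultimately show ?case by blast
  qed
qed

end

section \<open>Telescoping\<close>

lemma cf_point_eqI:
  "((n, s), (m, t)) \<in> cf_rel G S \<Longrightarrow> cf_point G S n s = cf_point G S m t"
  unfolding cf_point_def by (rule equiv_class_eq[OF equiv_cf_rel])

lemma cf_point_eqD:
  assumes "cf_point G S n s = cf_point G S m t" "s \<in> cf_level S n" "t \<in> cf_level S m"
  shows "((n, s), (m, t)) \<in> cf_rel G S"
  using assms eq_equiv_class_iff[OF equiv_cf_rel, of "(n, s)" S "(m, t)" G] by (auto simp: cf_point_def)

lemma funpow_diff_mono:
  fixes f :: "'a \<Rightarrow> 'a"
  assumes "(f ^^ (k - n)) s = (f ^^ (k - m)) t" "n \<le> k" "m \<le> k" "k \<le> k'"
  shows "(f ^^ (k' - n)) s = (f ^^ (k' - m)) t"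
proof -
  have "k' - n = (k' - k) + (k - n)" "k' - m = (k' - k) + (k - m)" using assms by auto
  then show ?thesis using assms(1) by (simp only: funpow_add o_apply)
qed

section \<open>Blocks of coordinates and the canonical isomorphism of a telescoping\<close>

context cf_system
begin

context
  fixes l :: "nat \<Rightarrow> nat"
  assumes l: "telescoping_seq l"
begin

abbreviation "tel \<equiv> cf_telescope G S l"

lemma l_mono: "i \<le> j \<Longrightarrow> l i \<le> l j"
  using l by (simp add: telescoping_seq_def strict_mono_less_eq)

lemma l_strict: "l n < l (Suc n)"
  using l by (simp add: telescoping_seq_def strict_mono_def)

lemma l_ge: "n \<le> l n"
  using l by (simp add: telescoping_seq_def strict_mono_imp_increasing)

lemma tel_C: "cfC tel (Suc n) = CC (l n) (l (Suc n))"
  by (simp add: cf_telescope_def CC_def)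

lemma tel_\<kappa>: "cf\<kappa> tel (Suc n) = KK (l n) (l (Suc n))"
  by (simp add: cf_telescope_def KK_def)

lemma tel_F: "cfF tel n = F (l n)"
  by (simp add: cf_telescope_def)

lemma tel_level_carrier: "s \<in> cf_level tel n \<Longrightarrow> s i \<in> carrier G"
proof (cases i)
  case 0
  then show "s \<in> cf_level tel n \<Longrightarrow> ?thesis" using F_carrier by (auto simp: mem_cf_level tel_F)
next
  case (Suc j)
  moreover have "CC (l (n + j)) (l (Suc (n + j))) \<subseteq> carrier G"
    using l_mono by (intro CC_carrier) auto
  ultimately show "s \<in> cf_level tel n \<Longrightarrow> ?thesis"
    using tel_C[of "n + j"] by (auto simp: mem_cf_level dest!: spec[of _ i])
qed

lemma block_level:
  assumes s: "s \<in> L (l n)"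
  shows "cf_block G l n s \<in> cf_level tel n"
  unfolding mem_cf_level
proof (intro conjI allI impI)
  show "cf_block G l n s 0 \<in> cfF tel n" using L_0[OF s] by (simp add: cf_block_def tel_F)
  fix i :: nat assume "i > 0"
  then obtain j where i: "i = Suc j" by (cases i) auto
  have "s (k - l n) \<in> C k" if "l (n + j) < k" for k
    using L_pos[OF s, of "k - l n"] that l_mono[of n "n + j"] by simp
  then have "list_all2 (\<in>) (map (\<lambda>k. s (k - l n)) [Suc (l (n + j))..<Suc (l (Suc (n + j)))])
      (map C [Suc (l (n + j))..<Suc (l (Suc (n + j)))])"
    by (auto simp: list_all2_conv_all_nth simp del: upt_Suc)
  then show "cf_block G l n s i \<in> cfC tel (n + i)"
    using list_mult_in_list_set_mult by (simp add: i cf_block_def tel_C CC_def del: upt_Suc)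
qed

text \<open>One embedding step in the telescoped space absorbs a whole block, that is
  \<open>l (Suc n) - l n\<close> embedding steps in the original one. This compatibility makes the
  canonical isomorphism independent of the representative.\<close>

lemma block_emb:
  assumes s: "s \<in> L (l n)"
  shows "emb (cf_block G l n s) = cf_block G l (Suc n) ((emb ^^ (l (Suc n) - l n)) s)"
proof
  fix i
  let ?d = "l (Suc n) - l n"
  have pow: "(emb ^^ ?d) s = (\<lambda>i. if i = 0 then list_mult G (map s [0..<Suc ?d]) else s (i + ?d))"
    using L_carrier[OF s] by (rule emb_pow_eq)
  show "emb (cf_block G l n s) i = cf_block G l (Suc n) ((emb ^^ ?d) s) i"
  proof (cases "i = 0")
    case True
    have "map (\<lambda>j. s (j - l n)) [Suc (l n)..<Suc (l (Suc n))] = map s [Suc 0..<Suc ?d]"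
      using l_strict[of n] by (intro nth_equalityI) (auto simp del: upt_Suc)
    moreover have "map s [0..<Suc ?d] = s 0 # map s [Suc 0..<Suc ?d]"
      by (simp add: upt_conv_Cons del: upt_Suc)
    ultimately show ?thesis
      using True by (simp add: emb_0 cf_block_def pow del: upt_Suc)
  next
    case False
    then obtain k where k: "i = Suc k" by (cases i) auto
    have eq: "map (\<lambda>j. s (j - l n)) [Suc (l (n + i))..<Suc (l (Suc (n + i)))] =
        map (\<lambda>j. ((emb ^^ ?d) s) (j - l (Suc n))) [Suc (l (n + i))..<Suc (l (Suc (n + i)))]"
    proof (rule map_cong[OF refl])
      fix j assume "j \<in> set [Suc (l (n + i))..<Suc (l (Suc (n + i)))]"
      then have "l (Suc n) < j" using l_mono[of "Suc n" "n + i"] k by auto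
      then show "s (j - l n) = ((emb ^^ ?d) s) (j - l (Suc n))"
        using l_strict[of n] by (simp add: pow)
    qed
    have "emb (cf_block G l n s) i =
        list_mult G (map (\<lambda>j. s (j - l n)) [Suc (l (n + i))..<Suc (l (Suc (n + i)))])"
      using False by (simp add: emb_pos cf_block_def del: upt_Suc)
    also have "\<dots> = cf_block G l (Suc n) ((emb ^^ ?d) s) i"
      unfolding eq using False by (simp add: cf_block_def del: upt_Suc)
    finally show ?thesis .
  qed
qed

lemma block_emb_pow:
  assumes s: "s \<in> L (l n)"
  shows "(emb ^^ j) (cf_block G l n s) = cf_block G l (n + j) ((emb ^^ (l (n + j) - l n)) s)"
proof (induction j)
  case (Suc j)
  have "(emb ^^ (l (n + j) - l n)) s \<in> L (l (n + j))"
    using emb_pow_level[OF s, of "l (n + j) - l n"] l_mono[of n "n + j"] by simp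
  then have "emb (cf_block G l (n + j) ((emb ^^ (l (n + j) - l n)) s)) =
      cf_block G l (Suc (n + j)) ((emb ^^ (l (Suc (n + j)) - l (n + j))) ((emb ^^ (l (n + j) - l n)) s))"
    by (rule block_emb)
  moreover have "l (Suc (n + j)) - l n = (l (Suc (n + j)) - l (n + j)) + (l (n + j) - l n)"
    using l_mono[of n "n + j"] l_mono[of "n + j" "Suc (n + j)"] by simp
  then have "(emb ^^ (l (Suc (n + j)) - l (n + j))) ((emb ^^ (l (n + j) - l n)) s) =
      (emb ^^ (l (Suc (n + j)) - l n)) s"
    by (simp only: funpow_add o_apply)
  ultimately show ?case by (simp add: Suc)
qed simp

lemma iso_eq:
  assumes s: "s \<in> L (l n)"
  shows "cf_telescope_iso G S l (pt (l n) s) = cf_point G tel n (cf_block G l n s)"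
  unfolding cf_telescope_iso_def
proof (rule the_equality)
  show "\<exists>m. \<exists>t\<in>L (l m). pt (l n) s = pt (l m) t \<and>
      cf_point G tel n (cf_block G l n s) = cf_point G tel m (cf_block G l m t)"
    using s by blast
next
  fix y
  assume "\<exists>m. \<exists>t\<in>L (l m). pt (l n) s = pt (l m) t \<and> y = cf_point G tel m (cf_block G l m t)"
  then obtain m t where t: "t \<in> L (l m)" "pt (l n) s = pt (l m) t"
    "y = cf_point G tel m (cf_block G l m t)" by blast
  have "((l n, s), (l m, t)) \<in> cf_rel G S" using cf_point_eqD[OF t(2) s t(1)] .
  then obtain k where k: "l n \<le> k" "l m \<le> k" "(emb ^^ (k - l n)) s = (emb ^^ (k - l m)) t"
    by (auto simp: cf_rel_def)
  \<comment> \<open>A telescoped level beyond \<open>n\<close> and \<open>m\<close> at which the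
    representatives already agree: \<open>k \<le> K \<le> l K\<close>.\<close>
  define K where "K = max k (max n m)"
  have K: "n \<le> K" "m \<le> K" "k \<le> l K" using l_ge[of K] by (auto simp: K_def)
  have "(emb ^^ (l K - l n)) s = (emb ^^ (l K - l m)) t"
    using k K by (intro funpow_diff_mono[OF k(3)]) auto
  then have "(emb ^^ (K - n)) (cf_block G l n s) = (emb ^^ (K - m)) (cf_block G l m t)"
    using block_emb_pow[OF s, of "K - n"] block_emb_pow[OF t(1), of "K - m"] K by simp
  then have "((m, cf_block G l m t), (n, cf_block G l n s)) \<in> cf_rel G tel"
    using K block_level[OF s] block_level[OF t(1)] by (auto simp: cf_rel_def)
  then show "y = cf_point G tel n (cf_block G l n s)"
    unfolding t(3) by (rule cf_point_eqI)
qed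

text \<open>Translates telescoped coordinates into cylinders of the original space: the partial
  products in the factor formula are the labels of \<open>x\<close> at the levels
  \<open>l (n + k)\<close>. The claim is eventual, since \<open>s\<close> and the blocks of a
  representative of \<open>x\<close> are only known to agree from some level on.\<close>

lemma iso_coordinates:
  assumes x: "x \<in> X" and s: "s \<in> cf_level tel n" "cf_telescope_iso G S l x = cf_point G tel n s"
  shows "\<forall>\<^sub>F k in sequentially. x \<in> cyl (l (n + k)) (list_mult G (map s [0..<Suc k]))"
proof -
  obtain m t0 where t0: "t0 \<in> L m" "x = pt m t0" using x by (rule X_cases)
  define t where "t = (emb ^^ (l m - m)) t0"
  have t: "t \<in> L (l m)" "x = pt (l m) t"
    using pt_emb_pow[OF t0(1), of "l m - m"] emb_pow_level[OF t0(1), of "l m - m"] l_ge[of m] t0(2)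
    by (simp_all add: t_def)
  have "((m, cf_block G l m t), (n, s)) \<in> cf_rel G tel"
    using s iso_eq[OF t(1)] t block_level[OF t(1)] by (intro cf_point_eqD) auto
  then obtain k0 where k0: "m \<le> k0" "n \<le> k0" "(emb ^^ (k0 - m)) (cf_block G l m t) = (emb ^^ (k0 - n)) s"
    by (auto simp: cf_rel_def)
  have "x \<in> cyl (l (n + k)) (list_mult G (map s [0..<Suc k]))" if "k \<ge> k0" for k
  proof -
    let ?e = "(emb ^^ (l (n + k) - l m)) t"
    have le: "m \<le> n + k" using that k0 by simp
    have "(emb ^^ (n + k - m)) (cf_block G l m t) = (emb ^^ (n + k - n)) s"
      using that k0 by (intro funpow_diff_mono[OF k0(3)]) auto
    then have "cf_block G l (n + k) ?e = (emb ^^ k) s"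
      using block_emb_pow[OF t(1), of "n + k - m"] le by simp
    moreover have "(emb ^^ k) s 0 = list_mult G (map s [0..<Suc k])"
      using emb_pow_eq[of s k] tel_level_carrier[OF s(1)] by simp
    ultimately have "?e 0 = list_mult G (map s [0..<Suc k])"
      by (metis cf_block_def)
    moreover have "x = pt (l (n + k)) ?e" "?e \<in> L (l (n + k))"
      using pt_emb_pow[OF t(1), of "l (n + k) - l m"] emb_pow_level[OF t(1), of "l (n + k) - l m"]
        t(2) l_mono[OF le] by simp_all
    ultimately show ?thesis unfolding cyl_iff by blast
  qed
  then show ?thesis by (auto simp only: eventually_sequentially)
qed

end

end

section \<open>Reduction of the factor formula to cylinder labels, and a Borel--Cantelli
  argument\<close>

context cf_measured
begin

text \<open>Both directions of the theorem obtain the formula from this criterion, which mentions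
  only the label \<open>h\<close> of \<open>x\<close> at the levels \<open>l n\<close>. A label is
  unique where it exists; the quantifier over \<open>h\<close> covers the early levels without
  one.\<close>

lemma factor_formulaI:
  assumes l: "telescoping_seq l"
    and ae: "AE x in \<mu>. \<tau> x \<in> lcosets \<Gamma> \<and>
      (\<forall>\<^sub>F n in sequentially. \<forall>h. x \<in> cyl (l n) h \<longrightarrow> (h \<otimes> g) <# \<Gamma> = \<tau> x)"
  shows "cf_factor_formula G S \<mu> \<Gamma> l g \<tau>"
  unfolding cf_factor_formula_def using ae AE_space
proof eventually_elim
  case (elim x)
  show ?case
  proof (intro allI ballI impI)
    fix n s
    assume s: "s \<in> cf_level (cf_telescope G S l) n"
      "cf_telescope_iso G S l x = cf_point G (cf_telescope G S l) n s"
    have "\<forall>\<^sub>F k in sequentially. x \<in> cyl (l (n + k)) (list_mult G (map s [0..<Suc k]))"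
      using iso_coordinates[OF l _ s] elim(2) by (simp add: space_\<mu>)
    moreover have "\<forall>\<^sub>F k in sequentially. \<forall>h. x \<in> cyl (l (n + k)) h \<longrightarrow> (h \<otimes> g) <# \<Gamma> = \<tau> x"
      using elim(1) unfolding eventually_sequentially by (metis trans_le_add2)
    ultimately have "\<forall>\<^sub>F k in sequentially.
        (list_mult G (map s [0..<Suc k]) \<otimes> g) <# \<Gamma> = \<tau> x"
      by eventually_elim blast
    then show "limitin (discrete_topology (lcosets \<Gamma>))
        (\<lambda>k. (list_mult G (map s [0..<Suc k]) \<otimes> g) <# \<Gamma>) (\<tau> x) sequentially"
      using elim(1) unfolding limitin_def by (auto elim: eventually_mono simp del: upt_Suc)
  qed
qed

lemma sum_\<nu>_CC:
  assumes "k \<le> n" "f \<in> F k"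
  shows "(\<Sum>c\<in>CC k n. \<nu> n (f \<otimes> c)) = \<nu> k f"
proof -
  have "(\<Sum>c\<in>CC k n. \<nu> n (f \<otimes> c)) = (\<Sum>c\<in>CC k n. \<nu> k f * pmf (KK k n) c)"
    using assms by (intro sum.cong refl \<nu>_mult_CC)
  also have "\<dots> = \<nu> k f"
    using assms finite_CC[of k n] by (simp add: sum_distrib_left[symmetric] sum_pmf_eq_1 set_pmf_KK)
  finally show ?thesis .
qed

text \<open>Borel--Cantelli for a possibly infinite \<open>\<mu>\<close>. The bound relative to each
  cylinder of level \<open>l n\<close> adds up to the same relative bound on any earlier cylinder,
  which has finite measure. The lemma is then applied to each of the countably many cylinders, which
  cover \<open>X\<close>.\<close>

lemma AE_eventually_notin_if_summable:
  fixes a :: "nat \<Rightarrow> real"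
  assumes l: "telescoping_seq l" and E: "\<And>n. E n \<in> sets \<mu>"
    and bound: "\<And>n h. h \<in> F (l n) \<Longrightarrow> measure \<mu> (cyl (l n) h \<inter> E n) \<le> a n * \<nu> (l n) h"
    and a: "summable a"
  shows "AE x in \<mu>. \<forall>\<^sub>F n in sequentially. x \<notin> E n"
proof -
  have "AE x in \<mu>. \<forall>\<^sub>F n in sequentially. \<not> (k \<le> l n \<and> x \<in> cyl k f \<and> x \<in> E n)"
    if f: "f \<in> F k" for k f
  proof -
    \<comment> \<open>The subdivision of \<open>cyl k f\<close> at level \<open>l n\<close> requires
      \<open>k \<le> l n\<close>. As \<open>n \<le> l n\<close>, this discards only finitely many
      indices.\<close>
    define A where "A n = (if k \<le> l n then cyl k f \<inter> E n else {})" for n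
    have A: "A n \<in> sets \<mu>" for n using E by (auto simp: A_def)
    have fin: "emeasure \<mu> (A n) < \<infinity>" for n
      using emeasure_mono[of "A n" "cyl k f" \<mu>] emeasure_cyl_finite[of k f]
      by (auto simp: A_def intro: le_less_trans)
    have le: "measure \<mu> (A n) \<le> a n * \<nu> k f" if n: "k \<le> l n" for n
    proof -
      have "A n = (\<Union>c\<in>CC k (l n). cyl (l n) (f \<otimes> c) \<inter> E n)"
        using cyl_split[OF n f] n by (auto simp: A_def)
      then have "measure \<mu> (A n) \<le> (\<Sum>c\<in>CC k (l n). measure \<mu> (cyl (l n) (f \<otimes> c) \<inter> E n))"
        using finite_CC[OF n] E by (simp only:) (intro measure_UNION_le sets.Int cyl_sets)
      also have "\<dots> \<le> (\<Sum>c\<in>CC k (l n). a n * \<nu> (l n) (f \<otimes> c))"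
        using F_mult_CC[OF n f] by (intro sum_mono bound)
      also have "\<dots> = a n * \<nu> k f"
        using sum_\<nu>_CC[OF n f] by (simp add: sum_distrib_left[symmetric])
      finally show ?thesis .
    qed
    have "summable (\<lambda>n. measure \<mu> (A n))"
    proof (rule summable_comparison_test'[where N = k])
      show "summable (\<lambda>n. a n * \<nu> k f)" using a by (rule summable_mult2)
      show "norm (measure \<mu> (A n)) \<le> a n * \<nu> k f" if "k \<le> n" for n
        using le[of n] that l_ge[OF l, of n] by simp
    qed
    then have "AE x in \<mu>. \<forall>\<^sub>F n in sequentially. x \<in> space \<mu> - A n"
      using A fin by (intro borel_cantelli_AE1)
    then show ?thesis
      by eventually_elim (auto elim!: eventually_mono simp: A_def split: if_splits)
  qed
  then have "AE x in \<mu>. \<forall>k. \<forall>f\<in>F k. \<forall>\<^sub>F n in sequentially. \<not> (k \<le> l n \<and> x \<in> cyl k f \<and> x \<in> E n)"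
    unfolding AE_all_countable AE_ball_countable[OF countable_finite[OF finite_F]] by blast
  then show ?thesis using AE_space
  proof eventually_elim
    case (elim x)
    then have "x \<in> X" by (simp add: space_\<mu>)
    then obtain m where "\<And>n. n \<ge> m \<Longrightarrow> \<exists>f\<in>F n. x \<in> cyl n f" by (rule X_cyl) blast
    then obtain f where f: "f \<in> F m" "x \<in> cyl m f" by blast
    have "\<forall>\<^sub>F n in sequentially. \<not> (m \<le> l n \<and> x \<in> cyl m f \<and> x \<in> E n)"
      using elim(1) f by blast
    moreover have "\<forall>\<^sub>F n in sequentially. m \<le> l n"
      using l_ge[OF l] unfolding eventually_sequentially by (metis le_trans)
    ultimately show ?case by eventually_elim (use f in auto)
  qed
qed

end

section \<open>From a factor map to a telescoping\<close>

context group
begin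

lemma lcosets_closed_lmult:
  assumes "subgroup H G" "a \<in> carrier G" "q \<in> lcosets H" shows "a <# q \<in> lcosets H"
proof -
  obtain b where "b \<in> carrier G" "q = b <# H" using assms by (auto simp: LCOSETS_def)
  then show ?thesis
    using assms subgroup.subset[of H G] by (auto simp: LCOSETS_def lcos_m_assoc)
qed

lemma inv_l_coset_cancel:
  assumes "subgroup H G" "a \<in> carrier G" "q \<in> lcosets H"
  shows "inv a <# (a <# q) = q" "a <# (inv a <# q) = q"
  using assms subgroup.lcosets_carrier[OF assms(1) is_group assms(3)]
  by (simp_all add: lcos_m_assoc lcos_mult_one)

end

locale cf_factor = cf_measured +
  fixes \<Gamma> :: "'a set" and \<tau> :: "(nat \<times> (nat \<Rightarrow> 'a)) set \<Rightarrow> 'a set"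
  assumes countable_G: "countable (carrier G)" and adm: "cf_admissible G S"
    and sub: "subgroup \<Gamma> G" and finite_Q: "finite (lcosets \<Gamma>)"
    and factor: "cf_factor_map G S \<mu> \<Gamma> \<tau>"
begin

abbreviation "Q \<equiv> lcosets \<Gamma>"

text \<open>A fibre of the factor map, not a transformation of the action.\<close>

definition "T q = \<tau> -` {q} \<inter> space \<mu>"

text \<open>\<open>pr m q\<close> is \<open>\<pi>\<^sub>m(q)\<close> in the outline above.\<close>

definition "pr m q = measure \<mu> (cyl m \<one> \<inter> T q) / \<nu> m \<one>"

lemma T_sets: "q \<in> Q \<Longrightarrow> T q \<in> sets \<mu>"
  using factor unfolding T_def cf_factor_map_def by (intro measurable_sets[of \<tau> \<mu> "count_space Q"]) auto

lemma \<tau>_Q: "x \<in> X \<Longrightarrow> \<tau> x \<in> Q"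
  using factor measurable_space[of \<tau> \<mu> "count_space Q" x] by (simp add: cf_factor_map_def space_\<mu>)

text \<open>By equivariance, the preimage of \<open>T (f <# q)\<close> under the action of
  \<open>f\<close> agrees with \<open>T q\<close> on \<open>cyl m \<one>\<close> up to a null set,
  and the action of \<open>f\<close> rescales measure on \<open>cyl m \<one>\<close> by a constant.
  So the distribution of \<open>\<tau>\<close> on \<open>cyl m f\<close> is the translate by
  \<open>f\<close> of the one on \<open>cyl m \<one>\<close>.\<close>

lemma measure_cyl_T:
  assumes f: "f \<in> F m" and q: "q \<in> Q"
  shows "measure \<mu> (cyl m f \<inter> T (f <# q)) = \<nu> m f * pr m q"
proof -
  have fc: "f \<in> carrier G" using f by (rule F_carrier)
  have T1: "T (f <# q) \<in> sets \<mu>" using lcosets_closed_lmult[OF sub fc q] by (rule T_sets)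
  have "emeasure \<mu> (cf_total_dom G S \<inter> cyl m \<one> \<inter> cf_act G S f -` T (f <# q)) =
      emeasure \<mu> (cyl m \<one> \<inter> T q)"
  proof (rule emeasure_eq_AE)
    have "AE x in \<mu>. \<tau> (cf_act G S f x) = f <# \<tau> x"
      using factor fc by (simp add: cf_factor_map_def)
    then show "AE x in \<mu>. x \<in> cf_total_dom G S \<inter> cyl m \<one> \<inter> cf_act G S f -` T (f <# q)
        \<longleftrightarrow> x \<in> cyl m \<one> \<inter> T q"
      using AE_total_dom[OF countable_G adm]
    proof eventually_elim
      case (elim x)
      have "x \<in> X" using elim(2) total_dom_sub by blast
      then have "\<tau> x \<in> Q" by (rule \<tau>_Q)
      then have "f <# \<tau> x = f <# q \<longleftrightarrow> \<tau> x = q"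
        using inv_l_coset_cancel(1)[OF sub fc] q by metis
      moreover have "cf_act G S f x \<in> X" if "x \<in> cyl m \<one>"
        using act_cyl[OF elim(2) that fc] f fc cyl_sub_X by (auto simp: subset_iff)
      ultimately show ?case using elim \<open>x \<in> X\<close> by (auto simp: T_def space_\<mu>)
    qed
  qed (use emeasure_vimage_act(2)[OF countable_G adm f T1] T_sets[OF q] in auto)
  then have eq: "ennreal (\<nu> m f) * emeasure \<mu> (cyl m \<one> \<inter> T q) =
      ennreal (\<nu> m \<one>) * emeasure \<mu> (cyl m f \<inter> T (f <# q))"
    using emeasure_vimage_act(1)[OF countable_G adm f T1] by simp
  have "\<nu> m f * measure \<mu> (cyl m \<one> \<inter> T q) = \<nu> m \<one> * measure \<mu> (cyl m f \<inter> T (f <# q))"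
    using arg_cong[OF eq, of enn2real] \<nu>_pos[OF f] \<nu>_pos[OF one_F, of m]
    by (simp add: enn2real_mult measure_def)
  then show ?thesis
    using \<nu>_pos[OF one_F, of m] by (simp add: pr_def field_simps)
qed

section \<open>The distributions \<open>pr m\<close> on the finite coset space and their behaviour
  in \<open>m\<close>\<close>

lemma cyl_T_fmeasurable: "q \<in> Q \<Longrightarrow> cyl m f \<inter> T q \<in> fmeasurable \<mu>"
  using T_sets by (intro fmeasurable_Int_fmeasurable fmeasurable_cyl)

lemma pr_nonneg: "pr m q \<ge> 0"
  using \<nu>_pos[OF one_F, of m] by (simp add: pr_def)

lemma sum_pr: "(\<Sum>q\<in>Q. pr m q) = 1"
proof -
  have "(\<Sum>q\<in>Q. measure \<mu> (cyl m \<one> \<inter> T q)) = measure \<mu> (\<Union>q\<in>Q. cyl m \<one> \<inter> T q)"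
    using cyl_T_fmeasurable finite_Q
    by (intro measure_finite_Union[symmetric]) (auto simp: disjoint_family_on_def T_def fmeasurableD2)
  also have "(\<Union>q\<in>Q. cyl m \<one> \<inter> T q) = cyl m \<one>"
    using cyl_sub_X[of m \<one>] \<tau>_Q by (auto simp: T_def space_\<mu>)
  finally show ?thesis
    using \<nu>_pos[OF one_F, of m] by (simp add: pr_def sum_divide_distrib[symmetric] measure_cyl)
qed

lemma pr_add_le_1:
  assumes "q \<in> Q" "q' \<in> Q" "q \<noteq> q'" shows "pr m q + pr m q' \<le> 1"
proof -
  have "(\<Sum>q\<in>{q, q'}. pr m q) \<le> (\<Sum>q\<in>Q. pr m q)"
    using assms finite_Q pr_nonneg by (intro sum_mono2) auto
  then show ?thesis using assms sum_pr by simp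
qed

lemma pr_le_1: assumes "q \<in> Q" shows "pr m q \<le> 1"
  using sum_mono2[OF finite_Q, of "{q}" "pr m"] assms pr_nonneg sum_pr by auto

text \<open>Split \<open>cyl m \<one>\<close> into the cylinders of the words \<open>c\<close> at
  level \<open>n\<close>; the share of the fibre over \<open>q\<close> in each is given by
  \<open>measure_cyl_T\<close>, applied to the coset \<open>inv c <# q\<close>.\<close>

lemma pr_eq_convolution:
  assumes n: "m \<le> n" and q: "q \<in> Q"
  shows "pr m q = (\<Sum>c\<in>CC m n. pmf (KK m n) c * pr n (inv c <# q))"
proof -
  have car: "c \<in> carrier G" if "c \<in> CC m n" for c using that CC_carrier[OF n] by blast
  have cF: "c \<in> F n" if "c \<in> CC m n" for c
    using F_mult_CC[OF n one_F that] car[OF that] by simp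
  have "cyl m \<one> \<inter> T q = (\<Union>c\<in>CC m n. cyl n c \<inter> T q)"
    using cyl_split[OF n one_F] car by auto
  then have "measure \<mu> (cyl m \<one> \<inter> T q) = (\<Sum>c\<in>CC m n. measure \<mu> (cyl n c \<inter> T q))"
    using cyl_T_fmeasurable[OF q] finite_CC[OF n] cyl_inj
    by (simp only:, intro measure_finite_Union) (auto simp: disjoint_family_on_def fmeasurableD2 fmeasurableD)
  also have "\<dots> = (\<Sum>c\<in>CC m n. \<nu> m \<one> * (pmf (KK m n) c * pr n (inv c <# q)))"
  proof (rule sum.cong[OF refl])
    fix c assume c: "c \<in> CC m n"
    have "\<nu> n c = \<nu> m \<one> * pmf (KK m n) c"
      using \<nu>_mult_CC[OF n one_F c] car[OF c] by simp
    then show "measure \<mu> (cyl n c \<inter> T q) = \<nu> m \<one> * (pmf (KK m n) c * pr n (inv c <# q))"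
      using measure_cyl_T[OF cF[OF c], of "inv c <# q"] lcosets_closed_lmult[OF sub _ q, of "inv c"]
        inv_l_coset_cancel(2)[OF sub car[OF c] q] car[OF c] by simp
  qed
  finally show ?thesis
    using \<nu>_pos[OF one_F, of m] by (simp add: pr_def[of m] sum_distrib_left[symmetric])
qed

lemma sum_KK: "m \<le> n \<Longrightarrow> (\<Sum>c\<in>CC m n. pmf (KK m n) c) = 1"
  using finite_CC by (intro sum_pmf_eq_1) (auto simp: set_pmf_KK)

text \<open>A value of \<open>pr m\<close> is an average of values of \<open>pr n\<close>, so it
  cannot exceed all of them: the maximum does not decrease with the level.\<close>

lemma pr_stays_large:
  assumes "m \<le> n" "q \<in> Q" "pr m q > b" shows "\<exists>q'\<in>Q. pr n q' > b"
proof (rule ccontr)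
  assume "\<not> (\<exists>q'\<in>Q. pr n q' > b)"
  then have *: "pr n q' \<le> b" if "q' \<in> Q" for q' using that by force
  have "pr m q \<le> (\<Sum>c\<in>CC m n. pmf (KK m n) c * b)"
    unfolding pr_eq_convolution[OF assms(1,2)]
  proof (intro sum_mono mult_left_mono * lcosets_closed_lmult[OF sub] assms(2) pmf_nonneg)
    show "inv c \<in> carrier G" if "c \<in> CC m n" for c
      using that CC_carrier[OF assms(1)] by auto
  qed
  also have "\<dots> = b" using sum_KK[OF assms(1)] by (simp add: sum_distrib_right[symmetric])
  finally show False using assms(3) by simp
qed

text \<open>A density argument. If every \<open>pr m q\<close> were at most \<open>b\<close>, the
  fibre over \<open>q\<close> would fill at most the fraction \<open>b\<close> of every cylinder,
  hence of every member of \<open>cyl_ring\<close>. But some member approximates a piece of the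
  fibre of positive measure so well that almost all of that member lies in the fibre.\<close>

lemma pr_large:
  assumes b: "b < 1" shows "\<exists>m. \<exists>q\<in>Q. pr m q > b"
proof (rule ccontr)
  assume "\<not> (\<exists>m. \<exists>q\<in>Q. pr m q > b)"
  then have le: "pr m q \<le> b" if "q \<in> Q" for m q using that by (meson leI)
  have "\<exists>q\<in>Q. pr 0 q > 0"
  proof (rule ccontr)
    assume "\<not> (\<exists>q\<in>Q. pr 0 q > 0)"
    then have "(\<Sum>q\<in>Q. pr 0 q) \<le> 0" by (intro sum_nonpos) force
    then show False using sum_pr[of 0] by simp
  qed
  then obtain q where q: "q \<in> Q" "pr 0 q > 0" by blast
  have b0: "b \<ge> 0" using le[OF q(1), of 0] q(2) by simp
  let ?A = "T q \<inter> cyl 0 \<one>"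
  define a where "a = measure \<mu> ?A"
  have a: "a > 0" using q(2) \<nu>_0 by (simp add: pr_def a_def Int_commute)
  \<comment> \<open>Chosen so that the final estimate
    \<open>a \<le> (a + \<delta>) * b + \<delta>\<close> is at most
    \<open>a * b + 2 * \<delta>\<close>, which falls below \<open>a\<close> by
    \<open>(1 - b) * a / 2\<close>.\<close>
  define \<delta> where "\<delta> = (1 - b) * a / 4"
  have "\<delta> > 0" using a b by (simp add: \<delta>_def)
  then obtain W where W: "W \<in> cyl_ring" "measure \<mu> (sym_diff ?A W) < \<delta>"
    using approx_by_cyl_ring[OF T_sets[OF q(1)]] by blast
  obtain n D where D: "D \<subseteq> F n" "W = (\<Union>f\<in>D. cyl n f)" using W by (auto simp: cyl_ring_def)
  have fD: "finite D" using D(1) finite_F by (rule finite_subset)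
  have Wf: "W \<in> fmeasurable \<mu>" using W by (intro cyl_ring_fmeasurable)
  have Af: "?A \<in> fmeasurable \<mu>" using T_sets[OF q(1)] by (rule fmeasurable_Int_cyl)
  have "T q \<inter> W = (\<Union>f\<in>D. cyl n f \<inter> T q)" using D by auto
  then have "measure \<mu> (T q \<inter> W) \<le> (\<Sum>f\<in>D. measure \<mu> (cyl n f \<inter> T q))"
    using fD T_sets[OF q(1)] by (simp only:) (intro measure_UNION_le sets.Int cyl_sets)
  also have "\<dots> \<le> (\<Sum>f\<in>D. \<nu> n f * b)"
  proof (rule sum_mono)
    fix f assume "f \<in> D"
    then have f: "f \<in> F n" "f \<in> carrier G" using D F_carrier by auto
    then have q': "inv f <# q \<in> Q" using lcosets_closed_lmult[OF sub _ q(1)] by simp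
    then have "measure \<mu> (cyl n f \<inter> T q) = \<nu> n f * pr n (inv f <# q)"
      using measure_cyl_T[OF f(1) q'] inv_l_coset_cancel(2)[OF sub f(2) q(1)] by simp
    then show "measure \<mu> (cyl n f \<inter> T q) \<le> \<nu> n f * b"
      using le[OF q'] \<nu>_pos[OF f(1)] by simp
  qed
  also have "\<dots> = measure \<mu> W * b"
    using measure_UN_cyl[OF D(1)] D(2) by (simp add: sum_distrib_right[symmetric])
  finally have 1: "measure \<mu> (T q \<inter> W) \<le> measure \<mu> W * b" .
  have sd: "sym_diff ?A W \<in> fmeasurable \<mu>" using Wf Af by (intro fmeasurable.Un fmeasurable.Diff)
  have TW: "T q \<inter> W \<in> fmeasurable \<mu>"
    using fmeasurable_Int_fmeasurable[OF Wf T_sets[OF q(1)]] by (simp add: Int_commute)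
  have "a \<le> measure \<mu> ((T q \<inter> W) \<union> sym_diff ?A W)"
    unfolding a_def using Af by (intro measure_mono_fmeasurable fmeasurable.Un[OF TW sd]) auto
  also have "\<dots> \<le> measure \<mu> (T q \<inter> W) + measure \<mu> (sym_diff ?A W)"
    by (intro measure_Un_le fmeasurableD[OF sd] fmeasurableD[OF TW])
  finally have 2: "a \<le> measure \<mu> (T q \<inter> W) + \<delta>" using W by simp
  have "measure \<mu> W \<le> measure \<mu> (?A \<union> sym_diff ?A W)"
    using Wf by (intro measure_mono_fmeasurable fmeasurable.Un[OF Af sd]) auto
  also have "\<dots> \<le> measure \<mu> ?A + measure \<mu> (sym_diff ?A W)"
    by (intro measure_Un_le fmeasurableD[OF sd] fmeasurableD[OF Af])
  finally have 3: "measure \<mu> W \<le> a + \<delta>" using W by (simp add: a_def)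
  have "a \<le> (a + \<delta>) * b + \<delta>"
    using 1 2 mult_right_mono[OF 3 b0] by linarith
  also have "\<dots> \<le> a * b + 2 * \<delta>"
    using mult_left_mono[of b 1 \<delta>] b \<open>\<delta> > 0\<close> by (simp add: algebra_simps)
  also have "\<dots> = a - (1 - b) * a / 2" by (simp add: \<delta>_def field_simps)
  finally show False using a b by (simp add: mult_le_0_iff)
qed

text \<open>Pigeonhole over the finite coset space. Otherwise each coset has a bound below 1 valid
  from some index on; the largest bound and the largest index contradict \<open>pr_large\<close>,
  carried to a late level by \<open>pr_stays_large\<close>.\<close>

lemma ex_limit_coset: "\<exists>q\<in>Q. \<forall>b<1. \<forall>N. \<exists>n\<ge>N. pr n q > b"
proof (rule ccontr)
  assume "\<not> (\<exists>q\<in>Q. \<forall>b<1. \<forall>N. \<exists>n\<ge>N. pr n q > b)"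
  then have "\<forall>q\<in>Q. \<exists>p. fst p < 1 \<and> (\<forall>n\<ge>snd p. pr n q \<le> fst p)"
    by (simp add: not_less)
  then obtain p where p: "\<And>q. q \<in> Q \<Longrightarrow> fst (p q) < 1"
    "\<And>q n. q \<in> Q \<Longrightarrow> n \<ge> snd (p q) \<Longrightarrow> pr n q \<le> fst (p q)" by metis
  have ne: "Q \<noteq> {}" using sum_pr[of 0] by auto
  define b where "b = Max ((\<lambda>q. fst (p q)) ` Q)"
  define N where "N = Max ((\<lambda>q. snd (p q)) ` Q)"
  have "b < 1" using finite_Q ne p by (simp add: b_def)
  then obtain m q where q: "q \<in> Q" "pr m q > b" using pr_large by blast
  then obtain q' where q': "q' \<in> Q" "pr (max m N) q' > b"
    using pr_stays_large[of m "max m N" q b] by auto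
  have "fst (p q') \<le> b" "snd (p q') \<le> N" using q' finite_Q by (auto simp: b_def N_def)
  then have "snd (p q') \<le> max m N" by linarith
  then show False using p(2)[OF q'(1), of "max m N"] q'(2) \<open>fst (p q') \<le> b\<close> by linarith
qed

lemma ex_telescoping:
  "\<exists>l. \<exists>g\<in>carrier G. telescoping_seq l \<and> cf_coset_summable G (cf_telescope G S l) \<Gamma> g \<and>
     cf_factor_formula G S \<mu> \<Gamma> l g \<tau>"
proof -
  obtain q where q: "q \<in> Q" "\<And>b N. b < 1 \<Longrightarrow> \<exists>n\<ge>N. pr n q > b" using ex_limit_coset by blast
  \<comment> \<open>The requirement at \<open>n = 0\<close> is only \<open>pr 0 q \<ge> 0\<close>,
    so the sequence can start at \<open>l 0 = 0\<close>, as a telescoping must.\<close>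
  have "\<exists>l. \<forall>n. ((n = 0 \<longrightarrow> l n = 0) \<and> pr (l n) q \<ge> 1 - (1/2)^n) \<and> l n < l (Suc n)"
  proof (rule dependent_nat_choice)
    show "\<exists>x. (0 = (0::nat) \<longrightarrow> x = 0) \<and> pr x q \<ge> 1 - (1/2)^0" using pr_nonneg by auto
    fix x n :: nat
    have "1 - (1/2)^Suc n < (1::real)" by simp
    then obtain y where "y \<ge> Suc x" "pr y q > 1 - (1/2)^Suc n" using q(2) by blast
    then show "\<exists>y. ((Suc n = 0 \<longrightarrow> y = 0) \<and> pr y q \<ge> 1 - (1/2)^Suc n) \<and> x < y"
      by (intro exI[of _ y]) auto
  qed
  then obtain l where l0: "l 0 = 0" and pl: "\<And>n. pr (l n) q \<ge> 1 - (1/2)^n"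
    and lS: "\<And>n. l n < l (Suc n)" by metis
  have l: "telescoping_seq l" using l0 lS by (simp add: telescoping_seq_def strict_mono_Suc_iff)
  obtain g where g: "g \<in> carrier G" "q = g <# \<Gamma>" using q(1) by (auto simp: LCOSETS_def)
  have sc: "\<Gamma> \<subseteq> carrier G" using sub by (rule subgroup.subset)
  have lq: "c <# q = (c \<otimes> g) <# \<Gamma>" if "c \<in> carrier G" for c
    using that g sc by (simp add: lcos_m_assoc)
  define bad where "bad n = {c \<in> CC (l n) (l (Suc n)). c \<notin> (g <# \<Gamma>) #> inv g}" for n
  \<comment> \<open>In the average for \<open>pr (l n) q\<close>, a bad \<open>c\<close> contributes
    the value of \<open>pr (l (Suc n))\<close> at a coset other than \<open>q\<close>, hence at most
    \<open>(1/2)^Suc n\<close>, and a good \<open>c\<close> at most 1. Since the average is at least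
    \<open>1 - (1/2)^n\<close>, bad words must be rare.\<close>
  have prob: "measure_pmf.prob (KK (l n) (l (Suc n))) (bad n) \<le> (1/2)^n + (1/2)^Suc n" for n
  proof -
    let ?K = "KK (l n) (l (Suc n))" and ?C = "CC (l n) (l (Suc n))" and ?e = "(1/2)^Suc n :: real"
    have le: "l n \<le> l (Suc n)" using lS[of n] by simp
    have fin: "finite ?C" using le by (rule finite_CC)
    have "1 - (1/2)^n \<le> pr (l n) q" by (rule pl)
    also have "\<dots> = (\<Sum>c\<in>?C. pmf ?K c * pr (l (Suc n)) (inv c <# q))"
      using le q(1) by (rule pr_eq_convolution)
    also have "\<dots> \<le> (\<Sum>c\<in>?C. pmf ?K c * (1 - indicator (bad n) c + ?e))"
    proof (intro sum_mono mult_left_mono pmf_nonneg)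
      fix c assume c: "c \<in> ?C"
      then have cc: "c \<in> carrier G" using CC_carrier[OF le] by blast
      then have q': "inv c <# q \<in> Q" using lcosets_closed_lmult[OF sub _ q(1)] by simp
      show "pr (l (Suc n)) (inv c <# q) \<le> 1 - indicator (bad n) c + ?e"
      proof (cases "c \<in> bad n")
        case True
        then have "c <# q \<noteq> q"
          using l_coset_eq_iff_conj[OF sub g(1) cc] g(2) lq[OF cc] by (auto simp: bad_def)
        then have "inv c <# q \<noteq> q" using inv_l_coset_cancel(2)[OF sub cc q(1)] by auto
        then show ?thesis
          using pr_add_le_1[OF q' q(1), of "l (Suc n)"] pl[of "Suc n"] True by simp
      next
        case False
        then show ?thesis using pr_le_1[OF q', of "l (Suc n)"] by (simp add: add_increasing2)
      qed
    qed
    also have "\<dots> = (\<Sum>c\<in>?C. pmf ?K c) * (1 + ?e) - (\<Sum>c\<in>?C. pmf ?K c * indicator (bad n) c)"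
    proof -
      have "pmf ?K c * (1 - indicator (bad n) c + ?e) = pmf ?K c * (1 + ?e) - pmf ?K c * indicator (bad n) c" for c
        by (simp add: algebra_simps)
      then show ?thesis by (simp only: sum_subtractf sum_distrib_right)
    qed
    also have "(\<Sum>c\<in>?C. pmf ?K c * indicator (bad n) c) = (\<Sum>c\<in>bad n. pmf ?K c)"
      using fin by (intro sum.mono_neutral_cong_right) (auto simp: bad_def)
    also have "\<dots> = measure_pmf.prob ?K (bad n)"
      using fin by (intro measure_measure_pmf_finite[symmetric]) (simp add: bad_def)
    finally show ?thesis using sum_KK[OF le] by simp
  qed
  have half: "summable (\<lambda>n. (1/2)^n :: real)" by (rule summable_geometric) simp
  then have "summable (\<lambda>n. (1/2)^n + (1/2)^Suc n :: real)"
    using summable_mult[OF half, of "1/2"] by (intro summable_add) simp_all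
  then have "summable (\<lambda>n. measure_pmf.prob (KK (l n) (l (Suc n))) (bad n))"
  proof (rule summable_comparison_test')
    show "norm (measure_pmf.prob (KK (l n) (l (Suc n))) (bad n)) \<le> (1/2)^n + (1/2)^Suc n" for n
      using prob[of n] by (simp only: real_norm_def abs_of_nonneg[OF measure_nonneg])
  qed
  then have summ: "cf_coset_summable G (cf_telescope G S l) \<Gamma> g"
    unfolding cf_coset_summable_def tel_C[OF l] tel_\<kappa>[OF l] bad_def .
  \<comment> \<open>The points at which \<open>\<tau>\<close> differs from the prediction
    \<open>h <# q\<close> made by the label at level \<open>l n\<close>. Its share of each cylinder
    of that level is \<open>1 - pr (l n) q\<close>.\<close>
  define E where "E n = (\<Union>h\<in>F (l n). cyl (l n) h - T (h <# q))" for n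
  have TF: "T (h <# q) \<in> sets \<mu>" if "h \<in> F n" for h n
    using lcosets_closed_lmult[OF sub F_carrier[OF that] q(1)] by (rule T_sets)
  have "AE x in \<mu>. \<forall>\<^sub>F n in sequentially. x \<notin> E n"
  proof (rule AE_eventually_notin_if_summable[OF l, where a = "\<lambda>n. (1/2)^n"])
    show "E n \<in> sets \<mu>" for n unfolding E_def using TF by (intro sets.finite_UN) auto
    show "summable (\<lambda>n. (1/2)^n :: real)" by (rule half)
    fix n h assume h: "h \<in> F (l n)"
    have "cyl (l n) h \<inter> E n = cyl (l n) h - cyl (l n) h \<inter> T (h <# q)"
      using h cyl_inj unfolding E_def by blast
    then have "measure \<mu> (cyl (l n) h \<inter> E n) = \<nu> (l n) h - \<nu> (l n) h * pr (l n) q"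
      using TF[OF h] measure_cyl_T[OF h q(1)] fmeasurable_cyl measure_cyl[OF h]
      by (simp add: measure_Diff fmeasurableD2)
    also have "\<dots> = (1 - pr (l n) q) * \<nu> (l n) h" by (simp add: algebra_simps)
    also have "\<dots> \<le> (1/2)^n * \<nu> (l n) h"
      using pl[of n] \<nu>_pos[OF h] by (intro mult_right_mono) auto
    finally show "measure \<mu> (cyl (l n) h \<inter> E n) \<le> (1/2)^n * \<nu> (l n) h" .
  qed
  then have "AE x in \<mu>. \<tau> x \<in> Q \<and>
      (\<forall>\<^sub>F n in sequentially. \<forall>h. x \<in> cyl (l n) h \<longrightarrow> (h \<otimes> g) <# \<Gamma> = \<tau> x)"
    using AE_space
  proof eventually_elim
    case (elim x)
    have "\<forall>\<^sub>F n in sequentially. \<forall>h. x \<in> cyl (l n) h \<longrightarrow> (h \<otimes> g) <# \<Gamma> = \<tau> x"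
      using elim(1)
    proof eventually_elim
      case (elim n)
      then show ?case using cyl_F[of x "l n"] lq F_carrier by (auto simp: E_def T_def)
    qed
    then show ?case using elim \<tau>_Q by (simp add: space_\<mu>)
  qed
  then have "cf_factor_formula G S \<mu> \<Gamma> l g \<tau>" by (rule factor_formulaI[OF l])
  then show ?thesis using l g summ by blast
qed

end

section \<open>From a telescoping to a factor map\<close>

context cf_measured
begin

text \<open>By summability, almost every point reads only finitely many words that move
  \<open>g <# \<Gamma>\<close>. From then on the coset predicted by its label is constant, and this
  limit is the factor map.\<close>

lemma ex_factor_map:
  assumes cnt: "countable (carrier G)" and adm: "cf_admissible G S"
    and sub: "subgroup \<Gamma> G" and fin: "finite (lcosets \<Gamma>)"
    and l: "telescoping_seq l" and g: "g \<in> carrier G"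
    and summ: "cf_coset_summable G (cf_telescope G S l) \<Gamma> g"
  shows "\<exists>\<tau>. cf_factor_map G S \<mu> \<Gamma> \<tau> \<and> cf_factor_formula G S \<mu> \<Gamma> l g \<tau>"
proof -
  let ?Q = "lcosets \<Gamma>"
  have sc: "\<Gamma> \<subseteq> carrier G" using sub by (rule subgroup.subset)
  have gQ: "a <# \<Gamma> \<in> ?Q" if "a \<in> carrier G" for a using that by (auto simp: LCOSETS_def)
  \<comment> \<open>\<open>ev x q\<close> says that the cosets predicted by the labels of
    \<open>x\<close> are eventually \<open>q\<close>. Where no such \<open>q\<close> exists,
    \<open>\<tau>\<close> takes the arbitrary value \<open>g <# \<Gamma>\<close>, so that it is
    coset-valued everywhere.\<close>
  define ev where "ev x q \<longleftrightarrow> (\<forall>\<^sub>F n in sequentially. \<forall>h. x \<in> cyl (l n) h \<longrightarrow> (h \<otimes> g) <# \<Gamma> = q)" for x q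
  define \<tau> where "\<tau> x = (if \<exists>q\<in>?Q. ev x q then SOME q. q \<in> ?Q \<and> ev x q else g <# \<Gamma>)" for x
  have ex_cyl: "\<forall>\<^sub>F n in sequentially. \<exists>h\<in>F (l n). x \<in> cyl (l n) h" if x: "x \<in> X" for x
  proof -
    obtain m where "\<And>n. n \<ge> m \<Longrightarrow> \<exists>h\<in>F n. x \<in> cyl n h" using x by (rule X_cyl) blast
    then show ?thesis using l_ge[OF l] unfolding eventually_sequentially by (metis le_trans)
  qed
  have ev_unique: "q = q'" if "x \<in> X" "ev x q" "ev x q'" for x q q'
  proof -
    have "\<forall>\<^sub>F n in sequentially. q = q'"
      using ex_cyl[OF that(1)] that(2,3) unfolding ev_def by eventually_elim blast
    then show ?thesis by simp
  qed
  have \<tau>_eq: "\<tau> x = q" if "x \<in> X" "q \<in> ?Q" "ev x q" for x q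
  proof -
    have "(SOME q. q \<in> ?Q \<and> ev x q) = q"
      using that ev_unique by (intro some_equality) auto
    then show ?thesis using that by (auto simp: \<tau>_def)
  qed
  have \<tau>_Q: "\<tau> x \<in> ?Q" for x
    using someI_ex[of "\<lambda>q. q \<in> ?Q \<and> ev x q"] gQ[OF g] by (auto simp: \<tau>_def)
  \<comment> \<open>For fixed \<open>n\<close> the labels violating the condition form a subset of
    the finite set \<open>F (l n)\<close>, so the condition excludes a finite union of
    cylinders.\<close>
  have ev_sets: "{x \<in> space \<mu>. ev x q} \<in> sets \<mu>" for q
  proof -
    have "{x \<in> space \<mu>. \<forall>h. x \<in> cyl (l n) h \<longrightarrow> (h \<otimes> g) <# \<Gamma> = q} =
        space \<mu> - (\<Union>h\<in>{h \<in> F (l n). (h \<otimes> g) <# \<Gamma> \<noteq> q}. cyl (l n) h)" for n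
      using cyl_F by blast
    also have "\<dots> n \<in> sets \<mu>" for n by (intro sets.Diff sets.top sets.finite_UN) auto
    finally show ?thesis
      unfolding ev_def by (rule sets_Collect_eventually_sequentially)
  qed
  have meas: "\<tau> \<in> measurable \<mu> (count_space ?Q)"
    unfolding measurable_count_space_eq_countable[OF countable_finite[OF fin]]
  proof (intro conjI ballI)
    show "\<tau> \<in> space \<mu> \<rightarrow> ?Q" using \<tau>_Q by blast
    fix q assume q: "q \<in> ?Q"
    have none: "{x \<in> space \<mu>. \<not> (\<exists>q\<in>?Q. ev x q)} \<in> sets \<mu>"
    proof -
      have "{x \<in> space \<mu>. \<not> (\<exists>q\<in>?Q. ev x q)} = space \<mu> - (\<Union>q\<in>?Q. {x \<in> space \<mu>. ev x q})" by blast
      also have "\<dots> \<in> sets \<mu>" using ev_sets fin by (intro sets.Diff sets.top sets.finite_UN) auto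
      finally show ?thesis .
    qed
    have "\<tau> -` {q} \<inter> space \<mu> = {x \<in> space \<mu>. ev x q} \<union>
        (if q = g <# \<Gamma> then {x \<in> space \<mu>. \<not> (\<exists>q\<in>?Q. ev x q)} else {})" (is "_ = ?R")
    proof (rule Set.set_eqI)
      fix x
      show "x \<in> \<tau> -` {q} \<inter> space \<mu> \<longleftrightarrow> x \<in> ?R"
      proof (cases "\<exists>q\<in>?Q. ev x q")
        case True
        then obtain p where p: "p \<in> ?Q" "ev x p" by blast
        then show ?thesis
          using \<tau>_eq[of x p] ev_unique[of x p q] by (auto simp: space_\<mu>)
      next
        case False
        then have "\<tau> x = g <# \<Gamma>" by (simp add: \<tau>_def)
        then show ?thesis using False q by auto
      qed
    qed
    then show "\<tau> -` {q} \<inter> space \<mu> \<in> sets \<mu>" using ev_sets none by simp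
  qed
  define bad where "bad n = {c \<in> CC (l n) (l (Suc n)). c \<notin> (g <# \<Gamma>) #> inv g}" for n
  \<comment> \<open>The points that pass from level \<open>l n\<close> to level
    \<open>l (Suc n)\<close> by a bad word. Its share of each cylinder of level \<open>l n\<close>
    is at most the probability of a bad word.\<close>
  define E where "E n = (\<Union>h\<in>F (l n). \<Union>c\<in>bad n. cyl (l (Suc n)) (h \<otimes> c))" for n
  have le: "l n \<le> l (Suc n)" for n using l_strict[OF l, of n] by simp
  have fbad: "finite (bad n)" for n using finite_CC[OF le] by (simp add: bad_def)
  have "AE x in \<mu>. \<forall>\<^sub>F n in sequentially. x \<notin> E n"
  proof (rule AE_eventually_notin_if_summable[OF l, where a = "\<lambda>n. measure_pmf.prob (KK (l n) (l (Suc n))) (bad n)"])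
    show "E n \<in> sets \<mu>" for n
      unfolding E_def using fbad by (intro sets.finite_UN finite_F cyl_sets)
    show "summable (\<lambda>n. measure_pmf.prob (KK (l n) (l (Suc n))) (bad n))"
      using summ unfolding cf_coset_summable_def tel_C[OF l] tel_\<kappa>[OF l] bad_def .
    fix n h assume h: "h \<in> F (l n)"
    have bC: "bad n \<subseteq> CC (l n) (l (Suc n))" by (auto simp: bad_def)
    have "cyl (l n) h \<inter> E n \<subseteq> (\<Union>c\<in>bad n. cyl (l (Suc n)) (h \<otimes> c))"
    proof
      fix x assume x: "x \<in> cyl (l n) h \<inter> E n"
      then obtain h' c where *: "h' \<in> F (l n)" "c \<in> bad n" "x \<in> cyl (l (Suc n)) (h' \<otimes> c)"
        by (auto simp: E_def)
      then have "x \<in> cyl (l n) h'" using cyl_mult_sub[OF le *(1)] bC by blast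
      then have "h' = h" using x cyl_inj by blast
      then show "x \<in> (\<Union>c\<in>bad n. cyl (l (Suc n)) (h \<otimes> c))" using * by blast
    qed
    then have sub': "cyl (l n) h \<inter> E n \<subseteq> (\<Union>f\<in>(\<otimes>) h ` bad n. cyl (l (Suc n)) f)"
      by simp
    have hb: "(\<otimes>) h ` bad n \<subseteq> F (l (Suc n))" using F_mult_CC[OF le h] bC by blast
    have "cyl (l n) h \<inter> E n \<in> sets \<mu>"
      unfolding E_def using fbad by (intro sets.Int sets.finite_UN finite_F cyl_sets)
    with sub' have "measure \<mu> (cyl (l n) h \<inter> E n) \<le> measure \<mu> (\<Union>f\<in>(\<otimes>) h ` bad n. cyl (l (Suc n)) f)"
      using fmeasurable_UN_cyl[OF hb] by (rule measure_mono_fmeasurable)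
    also have "\<dots> = (\<Sum>f\<in>(\<otimes>) h ` bad n. \<nu> (l (Suc n)) f)" using hb by (rule measure_UN_cyl)
    also have "\<dots> = (\<Sum>c\<in>bad n. \<nu> (l (Suc n)) (h \<otimes> c))"
    proof -
      have "bad n \<subseteq> carrier G" using bC CC_carrier[OF le] by blast
      then have "inj_on ((\<otimes>) h) (bad n)"
        using F_carrier[OF h] by (auto intro!: inj_onI simp: subset_iff)
      then show ?thesis by (simp add: sum.reindex)
    qed
    also have "\<dots> = (\<Sum>c\<in>bad n. \<nu> (l n) h * pmf (KK (l n) (l (Suc n))) c)"
      using bC by (intro sum.cong refl \<nu>_mult_CC[OF le h]) auto
    also have "\<dots> = measure_pmf.prob (KK (l n) (l (Suc n))) (bad n) * \<nu> (l n) h"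
      using fbad by (simp add: measure_measure_pmf_finite sum_distrib_left[symmetric])
    finally show "measure \<mu> (cyl (l n) h \<inter> E n) \<le>
        measure_pmf.prob (KK (l n) (l (Suc n))) (bad n) * \<nu> (l n) h" .
  qed
  then have ae: "AE x in \<mu>. \<exists>q\<in>?Q. ev x q"
    using AE_space
  proof eventually_elim
    case (elim x)
    then have x: "x \<in> X" by (simp add: space_\<mu>)
    have "\<forall>\<^sub>F n in sequentially. x \<notin> E n \<and> (\<exists>h\<in>F (l n). x \<in> cyl (l n) h)"
      using elim(1) ex_cyl[OF x] by eventually_elim blast
    then obtain N where N: "\<And>n. n \<ge> N \<Longrightarrow> x \<notin> E n" "\<And>n. n \<ge> N \<Longrightarrow> \<exists>h\<in>F (l n). x \<in> cyl (l n) h"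
      by (auto simp: eventually_sequentially)
    obtain h0 where h0: "h0 \<in> F (l N)" "x \<in> cyl (l N) h0" using N(2)[of N] by auto
    define q where "q = (h0 \<otimes> g) <# \<Gamma>"
    \<comment> \<open>A good word \<open>c\<close> fixes \<open>g <# \<Gamma>\<close>, so extending
      the label from \<open>h\<close> to \<open>h \<otimes> c\<close> leaves the predicted coset
      unchanged.\<close>
    have "\<forall>h. x \<in> cyl (l n) h \<longrightarrow> (h \<otimes> g) <# \<Gamma> = q" if "n \<ge> N" for n
      using that
    proof (induction rule: dec_induct)
      case base
      show ?case using h0 cyl_inj q_def by blast
    next
      case (step n)
      obtain h where h: "h \<in> F (l n)" "x \<in> cyl (l n) h" using N(2)[OF step(1)] by auto
      obtain c where c: "c \<in> CC (l n) (l (Suc n))" "x \<in> cyl (l (Suc n)) (h \<otimes> c)"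
        using h(2) le by (rule cyl_levelE)
      have cc: "c \<in> carrier G" using c CC_carrier[OF le] by blast
      have hc: "h \<in> carrier G" using h F_carrier by blast
      have "c \<notin> bad n" using N(1)[OF step(1)] h c by (auto simp: E_def)
      then have "(c \<otimes> g) <# \<Gamma> = g <# \<Gamma>"
        using c l_coset_eq_iff_conj[OF sub g cc] by (simp add: bad_def)
      then have "h <# ((c \<otimes> g) <# \<Gamma>) = h <# (g <# \<Gamma>)" by simp
      then have "(h \<otimes> c \<otimes> g) <# \<Gamma> = (h \<otimes> g) <# \<Gamma>"
        using hc cc g sc by (simp add: lcos_m_assoc m_assoc)
      also have "\<dots> = q" using step.IH h by blast
      finally show ?case using c(2) cyl_inj by blast
    qed
    then have "ev x q" unfolding ev_def eventually_sequentially by blast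
    moreover have "q \<in> ?Q" unfolding q_def using h0 F_carrier g by (intro gQ) auto
    ultimately show ?case by blast
  qed
  \<comment> \<open>At all late levels the action of \<open>a\<close> multiplies the label of
    \<open>x\<close> by \<open>a\<close> on the left, hence also the predicted coset and its
    limit.\<close>
  have "AE x in \<mu>. \<tau> (cf_act G S a x) = a <# \<tau> x" if a: "a \<in> carrier G" for a
    using ae AE_total_dom[OF cnt adm]
  proof eventually_elim
    case (elim x)
    then obtain q where q: "q \<in> ?Q" "ev x q" by blast
    have x: "x \<in> X" using elim(2) total_dom_sub by blast
    have "x \<in> cf_dom G S a" using elim(2) a by (auto simp: cf_total_dom_def)
    then obtain m where m: "\<And>n. n \<ge> m \<Longrightarrow> \<exists>h\<in>F n. x \<in> cyl n h \<and> a \<otimes> h \<in> F n"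
      using a by (rule dom_cyl) blast
    have "\<forall>\<^sub>F n in sequentially. n \<ge> m" by (rule eventually_ge_at_top)
    then have "ev (cf_act G S a x) (a <# q)"
      using q(2) unfolding ev_def
    proof eventually_elim
      case (elim n)
      obtain h where h: "h \<in> F (l n)" "x \<in> cyl (l n) h" "a \<otimes> h \<in> F (l n)"
        using m[of "l n"] elim(1) l_ge[OF l, of n] by auto
      then have "cf_act G S a x \<in> cyl (l n) (a \<otimes> h)"
        using \<open>x \<in> cf_total_dom G S\<close> a by (intro act_cyl)
      moreover have "(a \<otimes> h \<otimes> g) <# \<Gamma> = a <# q"
        using elim(2) h a g sc F_carrier[OF h(1)] lcos_m_assoc[OF sc a, of "h \<otimes> g"] by (auto simp: m_assoc)
      ultimately show ?case using cyl_inj by blast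
    qed
    moreover have "cf_act G S a x \<in> X"
      using m[of m] act_cyl[OF elim(2) _ a] cyl_sub_X by blast
    ultimately show ?case
      using \<tau>_eq[OF x q] \<tau>_eq[of "cf_act G S a x" "a <# q"] lcosets_closed_lmult[OF sub a q(1)] by simp
  qed
  then have "cf_factor_map G S \<mu> \<Gamma> \<tau>" using meas by (simp add: cf_factor_map_def)
  moreover have "cf_factor_formula G S \<mu> \<Gamma> l g \<tau>"
  proof (rule factor_formulaI[OF l])
    show "AE x in \<mu>. \<tau> x \<in> ?Q \<and>
        (\<forall>\<^sub>F n in sequentially. \<forall>h. x \<in> cyl (l n) h \<longrightarrow> (h \<otimes> g) <# \<Gamma> = \<tau> x)"
      using ae AE_space
    proof eventually_elim
      case (elim x)
      then obtain q where "q \<in> ?Q" "ev x q" by blast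
      moreover from this have "\<tau> x = q" using elim by (intro \<tau>_eq) (auto simp: space_\<mu>)
      ultimately show ?case by (simp add: ev_def)
    qed
  qed
  ultimately show ?thesis by blast
qed

end

theorem theoremC:
  fixes G :: "('a, 'b) monoid_scheme"
    and S :: "'a cf_data"
    and \<mu> :: "(nat \<times> (nat \<Rightarrow> 'a)) set measure"
    and \<Gamma> :: "'a set"
  assumes "group G" and "countable (carrier G)" and "infinite (carrier G)"
    and "cf_parameters G S" and "cf_admissible G S"
    and "cf_measure G S \<mu>"
    and "subgroup \<Gamma> G" and "finite (lcosets\<^bsub>G\<^esub> \<Gamma>)"
  shows "(cf_has_factor G S \<mu> \<Gamma> \<longleftrightarrow>
            (\<exists>l. \<exists>g\<in>carrier G. telescoping_seq l \<and>
               cf_coset_summable G (cf_telescope G S l) \<Gamma> g)) \<and>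
         (\<forall>l. \<forall>g\<in>carrier G. telescoping_seq l \<longrightarrow>
            cf_coset_summable G (cf_telescope G S l) \<Gamma> g \<longrightarrow>
            (\<exists>\<tau>. cf_factor_map G S \<mu> \<Gamma> \<tau> \<and> cf_factor_formula G S \<mu> \<Gamma> l g \<tau>)) \<and>
         (\<forall>\<tau>. cf_factor_map G S \<mu> \<Gamma> \<tau> \<longrightarrow>
            (\<exists>l. \<exists>g\<in>carrier G. telescoping_seq l \<and>
               cf_coset_summable G (cf_telescope G S l) \<Gamma> g \<and>
               cf_factor_formula G S \<mu> \<Gamma> l g \<tau>))"
proof -
  interpret cf_measured G S \<mu>
    using assms by (simp add: cf_measured_def cf_measured_axioms_def cf_system_def cf_system_axioms_def)
  have 1: "\<exists>\<tau>. cf_factor_map G S \<mu> \<Gamma> \<tau> \<and> cf_factor_formula G S \<mu> \<Gamma> l g \<tau>"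
    if "g \<in> carrier G" "telescoping_seq l" "cf_coset_summable G (cf_telescope G S l) \<Gamma> g" for l g
    using assms that by (intro ex_factor_map)
  have 2: "\<exists>l. \<exists>g\<in>carrier G. telescoping_seq l \<and> cf_coset_summable G (cf_telescope G S l) \<Gamma> g \<and>
      cf_factor_formula G S \<mu> \<Gamma> l g \<tau>" if "cf_factor_map G S \<mu> \<Gamma> \<tau>" for \<tau>
  proof -
    interpret cf_factor G S \<mu> \<Gamma> \<tau>
      by (intro cf_factor.intro cf_measured_axioms cf_factor_axioms.intro assms that)
    show ?thesis by (rule ex_telescoping)
  qed
  show ?thesis
    unfolding cf_has_factor_def using 1 2 by blast
qed

end
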